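(* Let $n\ge 2$ be an integer, let $K\ge 0$, and let $(M,\mathsf d,\mathsf m)$ be a proper metric measure space (every bounded closed subset of $M$ is compact) which satisfies the curvature-dimension condition $\mathsf{CD}(K,n)$. Let $p\in(1,n)$, and assume that for some $x_0\in M$ $$\liminf_{\rho\to 0}\frac{\mathsf m(B_{x_0}(\rho))}{\omega_n\rho^n}=1 .$$ If the $L^p$-logarithmic Sobolev inequality $$\int_M|u|^p\log|u|^p\,d\mathsf m\le\frac np\log\left(\mathcal C\,\||\nabla u|_{\mathsf d}\|_{L^p}^p\right)\qquad\text{for all } u\in\mathrm{Lip}_0(M)\text{ with }\|u\|_{L^p}=1$$ holds for some $\mathcal C\ge\mathcal L_{p,n}$, then $K=0$ and $$\mathsf m(B_x(\rho))\ge\left(\frac{\mathcal L_{p,n}}{\mathcal C}\right)^{\frac np}\omega_n\rho^n\qquad\text{for all } x\in M\text{ and }\rho\ge0.$$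
   Context: Metric measure space: $(M,\mathsf d)$ is a complete separable metric space and $\mathsf m$ is a locally finite Borel measure on $M$ that is strictly positive, i.e. $\mathrm{supp}[\mathsf m]=M$. $B_x(r)=\{y\in M:\mathsf d(x,y)<r\}$. $\omega_n=\pi^{n/2}/\Gamma(\frac n2+1)$. $\mathrm{Lip}_0(M)$ is the space of Lipschitz functions $u:M\to\mathbb R$ with compact support; for such $u$, $|\nabla u|_{\mathsf d}(x)=\limsup_{y\to x}\frac{|u(y)-u(x)|}{\mathsf d(x,y)}$, $x\in M$. $\|u\|_{L^p}=(\int_M|u|^p\,d\mathsf m)^{1/p}$. Conventions: $0\log 0=0$ and $\log 0=-\infty$. Curvature-dimension condition: $\mathcal P_2(M,\mathsf d)$ is the $L^2$-Wasserstein space of probability measures on $M$ and $\mathcal P_2(M,\mathsf d,\mathsf m)$ its subspace of $\mathsf m$-absolutely continuous measures. For $N\ge1$, the Rényi entropy is $S_N(\mu|\mathsf m)=-\int_M\rho^{-1/N}d\mu$, where $\rho$ is the density of the absolutely continuous part $\mu^c$ in the decomposition $\mu=\mu^c+\mu^s=\rho\,\mathsf m+\mu^s$. For $K\ge0$, $N\ge1$, $t\in[0,1]$, $s\ge0$ let $\tau_{K,N}^{(t)}(s)=+\infty$ if $Ks^2\ge (N-1)\pi^2$; $\tau_{K,N}^{(t)}(s)=t^{1/N}\left(\sin\left(\sqrt{\tfrac{K}{N-1}}\,ts\right)\big/\sin\left(\sqrt{\tfrac{K}{N-1}}\,s\right)\right)^{1-1/N}$ if $0<Ks^2<(N-1)\pi^2$;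 $\tau_{K,N}^{(t)}(s)=t$ if $Ks^2=0$. $(M,\mathsf d,\mathsf m)$ satisfies $\mathsf{CD}(K,N)$ if for all $\mu_0,\mu_1\in\mathcal P_2(M,\mathsf d,\mathsf m)$ there exist an optimal coupling $\pi$ of $\mu_0,\mu_1$ and a geodesic $\Gamma:[0,1]\to\mathcal P_2(M,\mathsf d,\mathsf m)$ joining $\mu_0$ and $\mu_1$ such that for every $t\in[0,1]$ and $N'\ge N$ $$S_{N'}(\Gamma(t)|\mathsf m)\le-\int_{M\times M}\left[\tau_{K,N'}^{(1-t)}(\mathsf d(y_0,y_1))\rho_0^{-1/N'}(y_0)+\tau_{K,N'}^{(t)}(\mathsf d(y_0,y_1))\rho_1^{-1/N'}(y_1)\right]d\pi(y_0,y_1),$$ where $\rho_0,\rho_1$ are the densities of $\mu_0,\mu_1$ with respect to $\mathsf m$. Constant: with $p'=\frac p{p-1}$, $$\mathcal L_{p,n}=\frac pn\left(\frac{p-1}e\right)^{p-1}\left(\omega_n\Gamma\left(\frac n{p'}+1\right)\right)^{-\frac pn},$$ which is the best constant in the $L^p$-logarithmic Sobolev inequality on $\mathbb R^n$. *)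

theory Defs
  imports "HOL-Probability.Probability"
begin

section \<open>Metric measure spaces\<close>

text \<open>
  The metric space is the carrier of a type of class \<open>polish_space\<close>, i.e. a complete separable
  metric space; \<open>m\<close> is the reference measure.
\<close>

definition measure_support :: "'a::topological_space measure \<Rightarrow> 'a set" where
  "measure_support m = {x. \<forall>U. open U \<and> x \<in> U \<longrightarrow> emeasure m U > 0}"

definition locally_finite_measure :: "'a::topological_space measure \<Rightarrow> bool" where
  "locally_finite_measure m \<longleftrightarrow> (\<forall>x. \<exists>U. open U \<and> x \<in> U \<and> emeasure m U < \<infinity>)"

definition metric_measure_space :: "'a::polish_space measure \<Rightarrow> bool" where
  "metric_measure_space m \<longleftrightarrow>
     sets m = sets borel \<and> locally_finite_measure m \<and> measure_support m = UNIV"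

definition proper_space :: "'a::metric_space itself \<Rightarrow> bool" where
  "proper_space _ \<longleftrightarrow> (\<forall>S::'a set. bounded S \<and> closed S \<longrightarrow> compact S)"


section \<open>Lipschitz functions and the logarithmic Sobolev inequality\<close>

definition Lip0 :: "('a::metric_space \<Rightarrow> real) set" where
  "Lip0 = {u. (\<exists>L. L-lipschitz_on UNIV u) \<and> compact (closure {x. u x \<noteq> 0})}"

text \<open>
  For Lipschitz \<open>u\<close> the upper limit is finite, so that \<open>enn2real\<close> loses nothing. At an isolated
  point the filter \<open>at x\<close> is trivial and the value is \<open>0\<close>.
\<close>

definition local_slope :: "('a::metric_space \<Rightarrow> real) \<Rightarrow> 'a \<Rightarrow> real" where
  "local_slope u x = enn2real (Limsup (at x) (\<lambda>y. ennreal (\<bar>u y - u x\<bar> / dist x y)))"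

definition Lp_norm :: "'a measure \<Rightarrow> real \<Rightarrow> ('a \<Rightarrow> real) \<Rightarrow> real" where
  "Lp_norm m p f = (LINT x|m. \<bar>f x\<bar> powr p) powr (1 / p)"

text \<open>
  Logarithm of a nonnegative number with the convention \<open>log 0 = -\<infinity>\<close>, whereas the library has
  \<open>ln 0 = 0\<close>. The convention matters: on a compact space \<open>Lip0\<close> contains the constants, whose
  slope vanishes.
\<close>

definition log0 :: "real \<Rightarrow> ereal" where
  "log0 x = (if x = 0 then -\<infinity> else ereal (ln x))"

text \<open>
  On the left-hand side \<open>0 log 0 = 0\<close> holds automatically, since \<open>0 powr p = 0\<close>.
\<close>

definition log_sobolev :: "'a::polish_space measure \<Rightarrow> nat \<Rightarrow> real \<Rightarrow> real \<Rightarrow> bool" where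
  "log_sobolev m n p C \<longleftrightarrow>
     (\<forall>u\<in>Lip0. Lp_norm m p u = 1 \<longrightarrow>
        ereal (LINT x|m. \<bar>u x\<bar> powr p * ln (\<bar>u x\<bar> powr p))
          \<le> ereal (real n / p) * log0 (C * Lp_norm m p (local_slope u) powr p))"

definition log_sobolev_const :: "real \<Rightarrow> nat \<Rightarrow> real" where
  "log_sobolev_const p n =
     (let p' = p / (p - 1) in
        p / real n * ((p - 1) / exp 1) powr (p - 1)
          * (unit_ball_vol (real n) * Gamma (real n / p' + 1)) powr (- p / real n))"


section \<open>Wasserstein space\<close>

definition P2 :: "'a::polish_space measure set" where
  "P2 = {\<mu>. prob_space \<mu> \<and> sets \<mu> = sets borel \<and>
            (\<exists>z. (\<integral>\<^sup>+ x. ennreal ((dist z x)\<^sup>2) \<partial>\<mu>) < \<infinity>)}"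

definition P2_ac :: "'a::polish_space measure \<Rightarrow> 'a measure set" where
  "P2_ac m = {\<mu> \<in> P2. absolutely_continuous m \<mu>}"

definition couplings ::
    "'a::polish_space measure \<Rightarrow> 'a measure \<Rightarrow> ('a \<times> 'a) measure set" where
  "couplings \<mu> \<nu> =
     {\<pi>. sets \<pi> = sets (borel \<Otimes>\<^sub>M borel) \<and> distr \<pi> borel fst = \<mu> \<and> distr \<pi> borel snd = \<nu>}"

definition transport_cost :: "('a::polish_space \<times> 'a) measure \<Rightarrow> ennreal" where
  "transport_cost \<pi> = (\<integral>\<^sup>+ z. ennreal ((dist (fst z) (snd z))\<^sup>2) \<partial>\<pi>)"

definition optimal_coupling ::
    "'a::polish_space measure \<Rightarrow> 'a measure \<Rightarrow> ('a \<times> 'a) measure \<Rightarrow> bool" where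
  "optimal_coupling \<mu> \<nu> \<pi> \<longleftrightarrow>
     \<pi> \<in> couplings \<mu> \<nu> \<and> (\<forall>\<pi>'\<in>couplings \<mu> \<nu>. transport_cost \<pi> \<le> transport_cost \<pi>')"

text \<open>The infimum is finite for \<open>\<mu>, \<nu> \<in> P2\<close>.\<close>

definition W2 :: "'a::polish_space measure \<Rightarrow> 'a measure \<Rightarrow> real" where
  "W2 \<mu> \<nu> = sqrt (enn2real (INF \<pi>\<in>couplings \<mu> \<nu>. transport_cost \<pi>))"

text \<open>Geodesics are minimizing and parametrized proportionally to arc length.\<close>

definition geodesic_in_P2_ac ::
    "'a::polish_space measure \<Rightarrow> (real \<Rightarrow> 'a measure) \<Rightarrow> 'a measure \<Rightarrow> 'a measure \<Rightarrow> bool" where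
  "geodesic_in_P2_ac m \<Gamma> \<mu> \<nu> \<longleftrightarrow>
     (\<forall>t\<in>{0..1}. \<Gamma> t \<in> P2_ac m) \<and> \<Gamma> 0 = \<mu> \<and> \<Gamma> 1 = \<nu> \<and>
     (\<forall>s\<in>{0..1}. \<forall>t\<in>{0..1}. W2 (\<Gamma> s) (\<Gamma> t) = \<bar>s - t\<bar> * W2 \<mu> \<nu>)"


section \<open>Renyi entropy and the curvature-dimension condition\<close>

definition singular_measures :: "'a measure \<Rightarrow> 'a measure \<Rightarrow> bool" where
  "singular_measures \<nu> m \<longleftrightarrow>
     (\<exists>A\<in>sets m. emeasure m A = 0 \<and> emeasure \<nu> (space m - A) = 0)"

text \<open>
  Density of the absolutely continuous part of \<open>\<mu>\<close> in its Lebesgue decomposition with respect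
  to \<open>m\<close>; it is determined \<open>m\<close>-almost everywhere.
\<close>

definition ac_density :: "'a measure \<Rightarrow> 'a measure \<Rightarrow> 'a \<Rightarrow> ennreal" where
  "ac_density m \<mu> =
     (SOME \<rho>. \<rho> \<in> borel_measurable m \<and>
        (\<exists>\<nu>. sets \<nu> = sets m \<and> singular_measures \<nu> m \<and>
             (\<forall>A\<in>sets m. emeasure \<mu> A = emeasure (density m \<rho>) A + emeasure \<nu> A)))"

text \<open>The power \<open>r powr (- 1 / N)\<close> on \<open>[0, \<infinity>]\<close>.\<close>

definition neg_root :: "real \<Rightarrow> ennreal \<Rightarrow> ennreal" where
  "neg_root N r =
     (if r = 0 then \<infinity> else if r = \<infinity> then 0 else ennreal (enn2real r powr (- 1 / N)))"

text \<open>
  The density is only defined up to \<open>m\<close>-null sets, so the integral runs over the absolutely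
  continuous part of \<open>\<mu>\<close>, the singular part contributing nothing. The value may be \<open>-\<infinity>\<close>.
\<close>

definition renyi_entropy :: "real \<Rightarrow> 'a measure \<Rightarrow> 'a measure \<Rightarrow> ereal" where
  "renyi_entropy N \<mu> m =
     - enn2ereal (\<integral>\<^sup>+ x. neg_root N (ac_density m \<mu> x) \<partial>(density m (ac_density m \<mu>)))"

text \<open>Intended for \<open>K \<ge> 0\<close>, \<open>N \<ge> 1\<close>, \<open>t \<in> [0, 1]\<close> and \<open>s \<ge> 0\<close>.\<close>

definition tau :: "real \<Rightarrow> real \<Rightarrow> real \<Rightarrow> real \<Rightarrow> ennreal" where
  "tau K N t s =
     (if K * s\<^sup>2 = 0 then ennreal t
      else if K * s\<^sup>2 \<ge> (N - 1) * pi\<^sup>2 then \<infinity>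
      else ennreal (t powr (1 / N)
             * (sin (sqrt (K / (N - 1)) * t * s) / sin (sqrt (K / (N - 1)) * s)) powr (1 - 1 / N)))"

text \<open>
  Both integrands are nonnegative, so both sides of the inequality are well defined in
  \<open>[-\<infinity>, 0]\<close>.
\<close>

definition CD :: "real \<Rightarrow> real \<Rightarrow> 'a::polish_space measure \<Rightarrow> bool" where
  "CD K N m \<longleftrightarrow>
     (\<forall>\<mu>0\<in>P2_ac m. \<forall>\<mu>1\<in>P2_ac m.
        \<exists>\<pi> \<Gamma>. optimal_coupling \<mu>0 \<mu>1 \<pi> \<and> geodesic_in_P2_ac m \<Gamma> \<mu>0 \<mu>1 \<and>
          (\<forall>t\<in>{0..1}. \<forall>N'\<ge>N.
             renyi_entropy N' (\<Gamma> t) m \<le>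
               - enn2ereal (\<integral>\<^sup>+ z.
                   tau K N' (1 - t) (dist (fst z) (snd z)) * neg_root N' (RN_deriv m \<mu>0 (fst z))
                 + tau K N' t (dist (fst z) (snd z)) * neg_root N' (RN_deriv m \<mu>1 (snd z)) \<partial>\<pi>)))"

end

theory Submission
  imports Defs
begin

text \<open>
  If \<open>K > 0\<close>, two distant balls would have \<open>\<tau> = \<infinity>\<close> in the curvature-dimension inequality, so the
  diameter is bounded, the space is compact, and a constant function violates the logarithmic
  Sobolev inequality. Hence \<open>K = 0\<close>, and the Brunn-Minkowski argument applied to the uniform
  measures on a small and a large concentric ball gives the Bishop-Gromov monotonicity of
  \<open>m (ball x r) / r^n\<close>.

  Let \<open>q = p / (p - 1)\<close> and \<open>F l = \<integral> exp (- l d(x0, x)^q) dm\<close>. Truncations of the Euclidean extremals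
  \<open>exp (- (l / p) d(x0, x)^q)\<close> turn the logarithmic Sobolev inequality into a differential
  inequality for \<open>F\<close> which holds with equality for a multiple of \<open>l powr (- n / q)\<close>. The density
  \<open>1\<close> at \<open>x0\<close> controls \<open>F\<close> as \<open>l \<rightarrow> \<infinity>\<close> and a minimum argument extends the lower bound to all
  \<open>l\<close>; letting \<open>l \<rightarrow> 0\<close> one reads off the asymptotic volume ratio, which by monotonicity bounds
  the volume of every ball from below.
\<close>

section \<open>Optimal transport\<close>

text \<open>The condition \<open>CD\<close> supplies a curve of measures, but neither geodesics of
  the space nor a plan on paths. To obtain a volume inequality one must know where the measure at
  time t lives. This follows from the \<open>W2\<close>-equalities alone: d(x, y)^2 is at most d(x,
  z)^2 / t + d(z, y)^2 / (1 - t), with equality only if d(x, z) = t * d(x, y), and along a geodesic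
  the integrated inequality is an equality up to arbitrarily small errors.

  On the analytic side put g = - l * F'(l) / F(l). The logarithmic Sobolev inequality bounds ln F
  from below by a function that decreases in g. This implicit differential inequality is never
  integrated; it is evaluated where g \<le> n / q, that is, where
  \<open>F l * l powr (n / q)\<close> has nonnegative derivative. There g = n / q may be inserted.
  The constant \<open>log_sobolev_const\<close> makes the resulting bound equal to the value for
  Lebesgue measure, \<open>unit_ball_vol n * Gamma (n / q + 1)\<close>. A larger C enters as (n / p)
  * ln C and costs the factor \<open>(log_sobolev_const p n / C) powr (n / p)\<close>.\<close>

lemma countable_cells:
  fixes \<delta> :: real
  assumes "\<delta> > 0"
  obtains c :: "'a::{metric_space,second_countable_topology} \<Rightarrow> nat"
  where "c \<in> borel \<rightarrow>\<^sub>M count_space UNIV" "\<And>x y. c x = c y \<Longrightarrow> dist x y < \<delta>"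
proof -
  obtain D :: "'a set" where D: "countable D" "\<And>X. open X \<Longrightarrow> X \<noteq> {} \<Longrightarrow> \<exists>d\<in>D. d \<in> X"
    using countable_dense_exists by blast
  define e where "e = from_nat_into D"
  \<comment> \<open>The first dense point within \<delta> / 2 labels the cell: points with the same
    label are closer than \<delta>, and a least index over the naturals is Borel.\<close>
  define c where "c x = (LEAST i. dist (e i) x < \<delta> / 2)" for x
  have ex: "\<exists>i. dist (e i) x < \<delta> / 2" for x
  proof -
    obtain d where "d \<in> D" "d \<in> ball x (\<delta> / 2)"
      using D(2)[of "ball x (\<delta> / 2)"] assms by auto
    then show ?thesis
      using from_nat_into_surj[OF D(1)] unfolding e_def by (metis dist_commute mem_ball)
  qed
  have c: "dist (e (c x)) x < \<delta> / 2" for x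
    unfolding c_def by (rule LeastI_ex[OF ex])
  have "c \<in> borel \<rightarrow>\<^sub>M count_space UNIV"
    unfolding c_def by measurable
  moreover have "dist x y < \<delta>" if "c x = c y" for x y
    using c[of x] c[of y] dist_triangle[of x y "e (c x)"] that by (simp add: dist_commute)
  ultimately show ?thesis by (rule that)
qed

section \<open>Couplings, their marginals and their gluing\<close>

lemma couplingsD:
  assumes "\<pi> \<in> couplings \<mu> \<nu>"
  shows couplings_sets: "sets \<pi> = sets (borel \<Otimes>\<^sub>M borel)"
    and couplings_fst: "distr \<pi> borel fst = \<mu>"
    and couplings_snd: "distr \<pi> borel snd = \<nu>"
  using assms by (auto simp: couplings_def)

lemma couplings_prob:
  assumes "\<pi> \<in> couplings \<mu> \<nu>" "prob_space \<mu>"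
  shows "prob_space \<pi>"
proof (rule prob_space_distrD)
  show "fst \<in> \<pi> \<rightarrow>\<^sub>M borel"
    using couplings_sets[OF assms(1)] by (simp cong: measurable_cong_sets)
  show "prob_space (distr \<pi> borel fst)"
    using assms couplings_fst by metis
qed

lemma couplings_prob_snd:
  assumes "\<pi> \<in> couplings \<mu> \<nu>" "prob_space \<nu>"
  shows "prob_space \<pi>"
proof (rule prob_space_distrD)
  show "snd \<in> \<pi> \<rightarrow>\<^sub>M borel"
    using couplings_sets[OF assms(1)] by (simp cong: measurable_cong_sets)
  show "prob_space (distr \<pi> borel snd)"
    using assms couplings_snd by metis
qed

lemma couplings_measurable:
  assumes "\<pi> \<in> couplings \<mu> \<nu>"
  shows "fst \<in> \<pi> \<rightarrow>\<^sub>M borel" "snd \<in> \<pi> \<rightarrow>\<^sub>M borel"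
  using couplings_sets[OF assms] by (simp_all cong: measurable_cong_sets)

lemma couplings_AE_fst:
  assumes "\<pi> \<in> couplings \<mu> \<nu>" "AE x in \<mu>. P x"
  shows "AE z in \<pi>. P (fst z)"
  using AE_distrD[OF couplings_measurable(1)[OF assms(1)], of P] assms(2)
  unfolding couplings_fst[OF assms(1)] by blast

lemma couplings_AE_snd:
  assumes "\<pi> \<in> couplings \<mu> \<nu>" "AE x in \<nu>. P x"
  shows "AE z in \<pi>. P (snd z)"
  using AE_distrD[OF couplings_measurable(2)[OF assms(1)], of P] assms(2)
  unfolding couplings_snd[OF assms(1)] by blast

text \<open>
  A substitute for the gluing lemma that needs no disintegration: the product of the two plans
  is reweighted so that the two middle points lie in a common cell of diameter less than \<open>\<delta>\<close>.
\<close>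

lemma approx_gluing:
  fixes \<mu> \<nu> \<xi> :: "'a::polish_space measure"
  assumes prob: "prob_space \<nu>" and p1: "\<pi>1 \<in> couplings \<mu> \<nu>" and p2: "\<pi>2 \<in> couplings \<nu> \<xi>"
    and \<delta>: "\<delta> > 0"
  obtains \<sigma> where
    "sets \<sigma> = sets ((borel \<Otimes>\<^sub>M borel) \<Otimes>\<^sub>M (borel \<Otimes>\<^sub>M borel))"
    "distr \<sigma> (borel \<Otimes>\<^sub>M borel) fst = \<pi>1" "distr \<sigma> (borel \<Otimes>\<^sub>M borel) snd = \<pi>2"
    "AE w in \<sigma>. dist (snd (fst w)) (fst (snd w)) < \<delta>"
proof -
  obtain c :: "'a \<Rightarrow> nat" where c[measurable]: "c \<in> borel \<rightarrow>\<^sub>M count_space UNIV"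
    and cd: "\<And>x y. c x = c y \<Longrightarrow> dist x y < \<delta>"
    using countable_cells[OF \<delta>] by blast
  have s1[measurable_cong]: "sets \<pi>1 = sets (borel \<Otimes>\<^sub>M borel)"
    and s2[measurable_cong]: "sets \<pi>2 = sets (borel \<Otimes>\<^sub>M borel)"
    using p1 p2 couplings_sets by auto
  interpret P1: prob_space \<pi>1 using couplings_prob_snd[OF p1 prob] .
  interpret P2: prob_space \<pi>2 using couplings_prob[OF p2 prob] .
  interpret N: prob_space \<nu> by fact
  interpret PP: pair_sigma_finite \<pi>1 \<pi>2 ..
  have sn[measurable_cong]: "sets \<nu> = sets borel"
    using couplings_snd[OF p1] by (metis sets_distr)
  have spn: "space \<nu> = UNIV" using sets_eq_imp_space_eq[OF sn] by simp
  define N where "N i = emeasure \<nu> (c -` {i})" for i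
  have cset: "c -` {i} \<in> sets borel" for i
    using measurable_sets[OF c, of "{i}"] by simp
  have N1: "emeasure \<pi>1 {w \<in> space \<pi>1. c (snd w) = i} = N i" for i
    unfolding N_def couplings_snd[OF p1, symmetric]
    by (subst emeasure_distr) (auto intro!: arg_cong[where f="emeasure \<pi>1"] couplings_measurable[OF p1] cset)
  have N2: "emeasure \<pi>2 {w \<in> space \<pi>2. c (fst w) = i} = N i" for i
    unfolding N_def couplings_fst[OF p2, symmetric]
    by (subst emeasure_distr) (auto intro!: arg_cong[where f="emeasure \<pi>2"] couplings_measurable[OF p2] cset)
  have Nfin: "N i \<noteq> \<infinity>" for i unfolding N_def using N.emeasure_finite by simp
  \<comment> \<open>The weight below divides by the mass of a cell; the cells without mass are
    countably many and together \<nu>-null.\<close>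
  have aeN: "AE z in \<nu>. N (c z) \<noteq> 0"
  proof -
    have "\<forall>i. AE z in \<nu>. N i = 0 \<longrightarrow> c z \<noteq> i"
    proof
      fix i
      show "AE z in \<nu>. N i = 0 \<longrightarrow> c z \<noteq> i"
      proof (cases "N i = 0")
        case True
        then show ?thesis
          by (intro AE_I[where N="c -` {i}"]) (auto simp: N_def cset sn)
      qed simp
    qed
    then have "AE z in \<nu>. \<forall>i. N i = 0 \<longrightarrow> c z \<noteq> i"
      by (simp add: AE_all_countable)
    then show ?thesis by eventually_elim blast
  qed
  \<comment> \<open>The density of choosing first the cell of the middle points and then, given the
    cell, the two plans independently. Each plan gives cell i the mass \<open>N i\<close>, so
    integrating out one factor yields 1 and restores the other plan.\<close>
  define k :: "('a \<times> 'a) \<times> ('a \<times> 'a) \<Rightarrow> ennreal" where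
    "k w = (if c (snd (fst w)) = c (fst (snd w)) then inverse (N (c (snd (fst w)))) else 0)" for w
  define iN where "iN z = inverse (N (c z))" for z
  have iN[measurable]: "iN \<in> borel_measurable borel"
    unfolding iN_def by (rule measurable_compose[OF c]) simp
  have k[measurable]: "k \<in> borel_measurable ((borel \<Otimes>\<^sub>M borel) \<Otimes>\<^sub>M (borel \<Otimes>\<^sub>M borel))"
  proof -
    have "Measurable.pred ((borel \<Otimes>\<^sub>M borel) \<Otimes>\<^sub>M (borel \<Otimes>\<^sub>M borel))
        (\<lambda>w. \<exists>i. c (fst (snd w)) = i \<and> c (snd (fst w)) = i)"
      by measurable
    then have [measurable]: "Measurable.pred ((borel \<Otimes>\<^sub>M borel) \<Otimes>\<^sub>M (borel \<Otimes>\<^sub>M borel))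
        (\<lambda>w. c (snd (fst w)) = c (fst (snd w)))"
      by simp
    show ?thesis unfolding k_def iN_def[symmetric] by measurable
  qed
  define \<sigma> where "\<sigma> = density (\<pi>1 \<Otimes>\<^sub>M \<pi>2) k"
  have ss[measurable_cong]: "sets \<sigma> = sets ((borel \<Otimes>\<^sub>M borel) \<Otimes>\<^sub>M (borel \<Otimes>\<^sub>M borel))"
    unfolding \<sigma>_def using s1 s2 by (simp cong: sets_pair_measure_cong)
  have inv: "inverse (N i) * N i = 1" if "N i \<noteq> 0" for i
    using that Nfin[of i] by (metis ennreal_divide_self divide_ennreal_def mult.commute infinity_ennreal_def less_top)
  have "distr \<sigma> (borel \<Otimes>\<^sub>M borel) fst = \<pi>1"
  proof (rule measure_eqI)
    fix A assume "A \<in> sets (distr \<sigma> (borel \<Otimes>\<^sub>M borel) fst)"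
    then have A[measurable]: "A \<in> sets (borel \<Otimes>\<^sub>M borel)" by simp
    have "emeasure (distr \<sigma> (borel \<Otimes>\<^sub>M borel) fst) A = (\<integral>\<^sup>+ w. indicator A (fst w) \<partial>\<sigma>)"
      by (subst nn_integral_indicator[symmetric], simp, subst nn_integral_distr) (auto simp: s1)
    also have "\<dots> = (\<integral>\<^sup>+ w. k w * indicator A (fst w) \<partial>(\<pi>1 \<Otimes>\<^sub>M \<pi>2))"
      unfolding \<sigma>_def by (subst nn_integral_density) auto
    also have "\<dots> = (\<integral>\<^sup>+ w1. (\<integral>\<^sup>+ w2. k (w1, w2) * indicator A (fst (w1, w2)) \<partial>\<pi>2) \<partial>\<pi>1)"
      by (subst P2.nn_integral_fst) auto
    also have "\<dots> = (\<integral>\<^sup>+ w1. indicator A w1 \<partial>\<pi>1)"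
    proof (rule nn_integral_cong_AE)
      have "AE w1 in \<pi>1. N (c (snd w1)) \<noteq> 0" by (rule couplings_AE_snd[OF p1 aeN])
      then show "AE w1 in \<pi>1. (\<integral>\<^sup>+ w2. k (w1, w2) * indicator A (fst (w1, w2)) \<partial>\<pi>2) = indicator A w1"
      proof eventually_elim
        case (elim w1)
        have "(\<integral>\<^sup>+ w2. k (w1, w2) * indicator A (fst (w1, w2)) \<partial>\<pi>2) =
          (\<integral>\<^sup>+ w2. (inverse (N (c (snd w1))) * indicator A w1) *
             indicator {w \<in> space \<pi>2. c (fst w) = c (snd w1)} w2 \<partial>\<pi>2)"
          by (rule nn_integral_cong) (auto simp: k_def indicator_def)
        also have "\<dots> = (inverse (N (c (snd w1))) * indicator A w1) * N (c (snd w1))"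
          by (subst nn_integral_cmult_indicator) (auto simp: N2)
        also have "\<dots> = indicator A w1 * (inverse (N (c (snd w1))) * N (c (snd w1)))"
          by (simp add: mult_ac)
        also have "\<dots> = indicator A w1"
          using inv[OF elim] by simp
        finally show ?case .
      qed
    qed
    also have "\<dots> = emeasure \<pi>1 A" by (simp add: s1)
    finally show "emeasure (distr \<sigma> (borel \<Otimes>\<^sub>M borel) fst) A = emeasure \<pi>1 A" .
  qed (simp add: s1)
  moreover have "distr \<sigma> (borel \<Otimes>\<^sub>M borel) snd = \<pi>2"
  proof (rule measure_eqI)
    fix A assume "A \<in> sets (distr \<sigma> (borel \<Otimes>\<^sub>M borel) snd)"
    then have A[measurable]: "A \<in> sets (borel \<Otimes>\<^sub>M borel)" by simp
    have "emeasure (distr \<sigma> (borel \<Otimes>\<^sub>M borel) snd) A = (\<integral>\<^sup>+ w. indicator A (snd w) \<partial>\<sigma>)"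
      by (subst nn_integral_indicator[symmetric], simp, subst nn_integral_distr) (auto simp: s1)
    also have "\<dots> = (\<integral>\<^sup>+ w. k w * indicator A (snd w) \<partial>(\<pi>1 \<Otimes>\<^sub>M \<pi>2))"
      unfolding \<sigma>_def by (subst nn_integral_density) auto
    also have "\<dots> = (\<integral>\<^sup>+ w2. (\<integral>\<^sup>+ w1. k (w1, w2) * indicator A (snd (w1, w2)) \<partial>\<pi>1) \<partial>\<pi>2)"
      by (subst PP.nn_integral_snd) (auto simp: split_beta')
    also have "\<dots> = (\<integral>\<^sup>+ w2. indicator A w2 \<partial>\<pi>2)"
    proof (rule nn_integral_cong_AE)
      have "AE w2 in \<pi>2. N (c (fst w2)) \<noteq> 0" by (rule couplings_AE_fst[OF p2 aeN])
      then show "AE w2 in \<pi>2. (\<integral>\<^sup>+ w1. k (w1, w2) * indicator A (snd (w1, w2)) \<partial>\<pi>1) = indicator A w2"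
      proof eventually_elim
        case (elim w2)
        have "(\<integral>\<^sup>+ w1. k (w1, w2) * indicator A (snd (w1, w2)) \<partial>\<pi>1) =
          (\<integral>\<^sup>+ w1. (inverse (N (c (fst w2))) * indicator A w2) *
             indicator {w \<in> space \<pi>1. c (snd w) = c (fst w2)} w1 \<partial>\<pi>1)"
          by (rule nn_integral_cong) (auto simp: k_def indicator_def)
        also have "\<dots> = (inverse (N (c (fst w2))) * indicator A w2) * N (c (fst w2))"
          by (subst nn_integral_cmult_indicator) (auto simp: N1)
        also have "\<dots> = indicator A w2 * (inverse (N (c (fst w2))) * N (c (fst w2)))"
          by (simp add: mult_ac)
        also have "\<dots> = indicator A w2"
          using inv[OF elim] by simp
        finally show ?case .
      qed
    qed
    also have "\<dots> = emeasure \<pi>2 A" by (simp add: s2)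
    finally show "emeasure (distr \<sigma> (borel \<Otimes>\<^sub>M borel) snd) A = emeasure \<pi>2 A" .
  qed (simp add: s2)
  moreover have "AE w in \<sigma>. dist (snd (fst w)) (fst (snd w)) < \<delta>"
    unfolding \<sigma>_def by (subst AE_density) (auto simp: k_def intro!: AE_I2 cd split: if_splits)
  ultimately show ?thesis using that ss by blast
qed

lemma product_coupling:
  assumes "prob_space \<mu>" "prob_space \<nu>" "sets \<mu> = sets borel" "sets \<nu> = sets borel"
  shows "\<mu> \<Otimes>\<^sub>M \<nu> \<in> couplings \<mu> \<nu>"
proof -
  interpret M: prob_space \<mu> by fact
  interpret N: prob_space \<nu> by fact
  interpret PP: pair_sigma_finite \<nu> \<mu> ..
  have "distr (\<mu> \<Otimes>\<^sub>M \<nu>) borel fst = \<mu>"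
  proof -
    have "distr (\<mu> \<Otimes>\<^sub>M \<nu>) borel fst = distr (\<mu> \<Otimes>\<^sub>M \<nu>) \<mu> fst"
      by (rule distr_cong) (auto simp: assms)
    then show ?thesis using N.distr_pair_fst by simp
  qed
  moreover have "distr (\<mu> \<Otimes>\<^sub>M \<nu>) borel snd = \<nu>"
  proof (rule measure_eqI)
    fix A assume "A \<in> sets (distr (\<mu> \<Otimes>\<^sub>M \<nu>) borel snd)"
    then have A: "A \<in> sets \<nu>" by (simp add: assms)
    have "emeasure (distr (\<mu> \<Otimes>\<^sub>M \<nu>) borel snd) A = emeasure (\<mu> \<Otimes>\<^sub>M \<nu>) (space \<mu> \<times> A)"
      using A sets.sets_into_space[OF A]
      by (subst emeasure_distr) (auto simp: assms space_pair_measure sets_eq_imp_space_eq[OF assms(4)]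
          intro!: arg_cong[where f="emeasure (\<mu> \<Otimes>\<^sub>M \<nu>)"] measurable_snd'' cong: measurable_cong_sets)
    also have "\<dots> = emeasure \<nu> A"
      using A by (simp add: N.emeasure_pair_measure_Times M.emeasure_space_1)
    finally show "emeasure (distr (\<mu> \<Otimes>\<^sub>M \<nu>) borel snd) A = emeasure \<nu> A" .
  qed (simp add: assms)
  ultimately show ?thesis
    using assms by (simp add: couplings_def cong: sets_pair_measure_cong)
qed

section \<open>The Wasserstein distance as an infimum of costs\<close>

lemma transport_cost_finite:
  assumes "\<mu> \<in> P2" "\<nu> \<in> P2"
  shows "(INF \<pi>\<in>couplings \<mu> \<nu>. transport_cost \<pi>) < \<infinity>"
proof -
  have pm: "prob_space \<mu>" "prob_space \<nu>" and sm[measurable_cong]: "sets \<mu> = sets borel" "sets \<nu> = sets borel"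
    using assms by (auto simp: P2_def)
  interpret M: prob_space \<mu> by fact
  interpret N: prob_space \<nu> by fact
  obtain a b where a: "(\<integral>\<^sup>+ x. ennreal ((dist a x)\<^sup>2) \<partial>\<mu>) < \<infinity>"
    and b: "(\<integral>\<^sup>+ x. ennreal ((dist b x)\<^sup>2) \<partial>\<nu>) < \<infinity>"
    using assms by (auto simp: P2_def)
  have c: "\<mu> \<Otimes>\<^sub>M \<nu> \<in> couplings \<mu> \<nu>" using product_coupling pm sm by blast
  \<comment> \<open>The factor 3 comes from \<open>(u + v + w)\<^sup>2 \<le> 3 * (u\<^sup>2 +
    v\<^sup>2 + w\<^sup>2)\<close>; the base points of the two second moments may differ.\<close>
  have ineq: "(dist x y)\<^sup>2 \<le> 3 * (dist a x)\<^sup>2 + (3 * (dist a b)\<^sup>2 + 3 * (dist b y)\<^sup>2)" for x y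
  proof -
    have "dist x y \<le> dist a x + dist a b + dist b y"
      using dist_triangle[of x y a] dist_triangle[of a y b] by (simp add: dist_commute)
    then have "(dist x y)\<^sup>2 \<le> (dist a x + dist a b + dist b y)\<^sup>2" by (intro power_mono) auto
    also have "\<dots> \<le> 3 * (dist a x)\<^sup>2 + (3 * (dist a b)\<^sup>2 + 3 * (dist b y)\<^sup>2)"
      using sum_squares_bound[of "dist a x" "dist a b"] sum_squares_bound[of "dist a x" "dist b y"]
        sum_squares_bound[of "dist a b" "dist b y"]
      by (simp add: power2_eq_square algebra_simps)
    finally show ?thesis .
  qed
  have "transport_cost (\<mu> \<Otimes>\<^sub>M \<nu>) \<le> (\<integral>\<^sup>+ z. 3 * ennreal ((dist a (fst z))\<^sup>2) +
      (ennreal (3 * (dist a b)\<^sup>2) + 3 * ennreal ((dist b (snd z))\<^sup>2)) \<partial>(\<mu> \<Otimes>\<^sub>M \<nu>))"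
    unfolding transport_cost_def
  proof (rule nn_integral_mono)
    fix z
    show "ennreal ((dist (fst z) (snd z))\<^sup>2) \<le> 3 * ennreal ((dist a (fst z))\<^sup>2) +
      (ennreal (3 * (dist a b)\<^sup>2) + 3 * ennreal ((dist b (snd z))\<^sup>2))"
      using ennreal_leI[OF ineq[of "fst z" "snd z"]]
      by (simp add: ennreal_mult'' flip: ennreal_numeral)
  qed
  also have "\<dots> = 3 * (\<integral>\<^sup>+ z. ennreal ((dist a (fst z))\<^sup>2) \<partial>(\<mu> \<Otimes>\<^sub>M \<nu>)) +
      (ennreal (3 * (dist a b)\<^sup>2) * emeasure (\<mu> \<Otimes>\<^sub>M \<nu>) (space (\<mu> \<Otimes>\<^sub>M \<nu>))
        + 3 * (\<integral>\<^sup>+ z. ennreal ((dist b (snd z))\<^sup>2) \<partial>(\<mu> \<Otimes>\<^sub>M \<nu>)))"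
    by (simp add: nn_integral_add nn_integral_cmult)
  also have "(\<integral>\<^sup>+ z. ennreal ((dist a (fst z))\<^sup>2) \<partial>(\<mu> \<Otimes>\<^sub>M \<nu>)) = (\<integral>\<^sup>+ x. ennreal ((dist a x)\<^sup>2) \<partial>\<mu>)"
    by (subst couplings_fst[OF c, symmetric], subst nn_integral_distr) auto
  also have "(\<integral>\<^sup>+ z. ennreal ((dist b (snd z))\<^sup>2) \<partial>(\<mu> \<Otimes>\<^sub>M \<nu>)) = (\<integral>\<^sup>+ x. ennreal ((dist b x)\<^sup>2) \<partial>\<nu>)"
    by (subst couplings_snd[OF c, symmetric], subst nn_integral_distr) auto
  also have "emeasure (\<mu> \<Otimes>\<^sub>M \<nu>) (space (\<mu> \<Otimes>\<^sub>M \<nu>)) = 1"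
    using prob_space.emeasure_space_1[OF couplings_prob[OF c pm(1)]] .
  also have "3 * (\<integral>\<^sup>+ x. ennreal ((dist a x)\<^sup>2) \<partial>\<mu>) + (ennreal (3 * (dist a b)\<^sup>2) * 1 +
      3 * (\<integral>\<^sup>+ x. ennreal ((dist b x)\<^sup>2) \<partial>\<nu>)) < \<infinity>"
    using a b by (simp add: ennreal_mult_less_top)
  finally have "transport_cost (\<mu> \<Otimes>\<^sub>M \<nu>) < \<infinity>" .
  then show ?thesis using INF_lower[OF c, of transport_cost] by (rule le_less_trans[rotated])
qed

text \<open>If the infimum were infinite, \<open>enn2real\<close> would make \<open>W2\<close> zero,
  and the estimate survives.\<close>

lemma W2_le_cost:
  assumes "\<pi> \<in> couplings \<mu> \<nu>"
  shows "ennreal ((W2 \<mu> \<nu>)\<^sup>2) \<le> transport_cost \<pi>"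
proof -
  have "ennreal ((W2 \<mu> \<nu>)\<^sup>2) \<le> (INF \<pi>\<in>couplings \<mu> \<nu>. transport_cost \<pi>)"
    unfolding W2_def by (cases "(INF \<pi>\<in>couplings \<mu> \<nu>. transport_cost \<pi>)") auto
  also have "\<dots> \<le> transport_cost \<pi>" by (rule INF_lower[OF assms])
  finally show ?thesis .
qed

text \<open>Plans within \<delta> of the infimum are enough to localize the intermediate measure, so
  existence of optimal plans is not invoked there.\<close>

lemma W2_near_optimal:
  assumes "\<mu> \<in> P2" "\<nu> \<in> P2" "\<delta> > 0"
  obtains \<pi> where "\<pi> \<in> couplings \<mu> \<nu>" "transport_cost \<pi> \<le> ennreal ((W2 \<mu> \<nu>)\<^sup>2 + \<delta>)"
proof -
  let ?I = "INF \<pi>\<in>couplings \<mu> \<nu>. transport_cost \<pi>"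
  have "?I = ennreal ((W2 \<mu> \<nu>)\<^sup>2)"
    using transport_cost_finite[OF assms(1,2)] by (simp add: W2_def)
  then have "?I < ennreal ((W2 \<mu> \<nu>)\<^sup>2 + \<delta>)"
    using assms(3) by (simp add: ennreal_lessI add_nonneg_pos)
  then show ?thesis
    using that unfolding INF_less_iff by (meson less_imp_le)
qed

text \<open>Minimizing \<alpha>^2 / t + \<beta>^2 / (1 - t) under \<alpha> + \<beta> \<ge> l gives
  l^2, attained at \<alpha> = t * l. Expanding about this minimizer retains the excess of the first
  term; the slack \<delta> costs 2 * l * \<delta>, which D makes uniform.\<close>

lemma intermediate_cost_bound:
  fixes l D t \<delta> :: real
  assumes t: "0 < t" "t < 1" and l: "0 \<le> l" "l \<le> D" "l \<le> \<alpha> + \<beta> + \<delta>" and "0 \<le> \<delta>"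
  shows "l\<^sup>2 + (\<alpha> - t * l)\<^sup>2 / t \<le> \<alpha>\<^sup>2 / t + \<beta>\<^sup>2 / (1 - t) + 2 * D * \<delta>"
proof -
  define u where "u = \<alpha> - t * l"
  have a: "\<alpha>\<^sup>2 / t = t * l\<^sup>2 + 2 * l * u + u\<^sup>2 / t"
    using t unfolding u_def by (simp add: field_simps power2_eq_square)
  have "0 \<le> (\<beta> - (1 - t) * l)\<^sup>2 / (1 - t)" using t by simp
  also have "\<dots> = \<beta>\<^sup>2 / (1 - t) - 2 * l * \<beta> + (1 - t) * l\<^sup>2"
    using t by (simp add: field_simps power2_eq_square)
  finally have b: "\<beta>\<^sup>2 / (1 - t) \<ge> 2 * l * \<beta> - (1 - t) * l\<^sup>2" by simp
  have "l * \<beta> \<ge> l * ((1 - t) * l - u - \<delta>)"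
    using l unfolding u_def by (intro mult_left_mono) (auto simp: algebra_simps)
  moreover have "l * \<delta> \<le> D * \<delta>" using l \<open>0 \<le> \<delta>\<close> by (intro mult_right_mono) auto
  ultimately show ?thesis
    using a b unfolding u_def[symmetric] by (simp add: algebra_simps power2_eq_square)
qed

text \<open>Weighted by 1 / t and 1 / (1 - t), the squared distances in \<open>W\<close> add up to
  exactly \<open>(W2 \<mu> \<xi>)\<^sup>2\<close>. A composite plan costs at least that much, so
  nothing is left to pay for middle points z with d(x, z) well above t * d(x, y). The radius is
  \<epsilon>, for the way from a to x, plus t times the largest possible d(x, y), plus an arbitrary
  margin \<eta>.\<close>

lemma intermediate_measure_concentrated:
  fixes \<mu> \<nu> \<xi> :: "'a::polish_space measure"
  assumes P2: "\<mu> \<in> P2" "\<nu> \<in> P2" "\<xi> \<in> P2"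
    and A: "AE x in \<mu>. dist a x \<le> \<epsilon>" and B: "AE y in \<xi>. dist b y \<le> R"
    and t: "0 < t" "t < 1"
    and W: "W2 \<mu> \<nu> = t * W2 \<mu> \<xi>" "W2 \<nu> \<xi> = (1 - t) * W2 \<mu> \<xi>"
    and nn: "0 \<le> \<epsilon>" "0 \<le> R"
    and \<eta>: "\<eta> > 0"
  shows "AE z in \<nu>. dist a z \<le> \<epsilon> + t * (dist a b + \<epsilon> + R) + \<eta>"
proof -
  define D where "D = dist a b + \<epsilon> + R"
  have D0: "D \<ge> 0" unfolding D_def using nn by simp
  define w where "w = W2 \<mu> \<xi>"
  have pm: "prob_space \<mu>" "prob_space \<nu>" "prob_space \<xi>"
    and sm[measurable_cong]: "sets \<mu> = sets borel" "sets \<nu> = sets borel" "sets \<xi> = sets borel"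
    using P2 by (auto simp: P2_def)
  interpret N: prob_space \<nu> by fact
  define E where "E = {z. dist a z > \<epsilon> + t * D + \<eta>}"
  have E[measurable]: "E \<in> sets borel" unfolding E_def by measurable
  \<comment> \<open>The factor of \<delta> collects the slack of the two near-optimal plans,
    weighted by 1 / t and 1 / (1 - t), and the gap left by the gluing.\<close>
  have small: "measure \<nu> E * (\<eta>\<^sup>2 / t) \<le> \<delta> * (1 / t + 1 / (1 - t) + 2 * D)" if \<delta>: "\<delta> > 0" for \<delta>
  proof -
    obtain \<pi>1 where p1: "\<pi>1 \<in> couplings \<mu> \<nu>" and c1: "transport_cost \<pi>1 \<le> ennreal ((W2 \<mu> \<nu>)\<^sup>2 + \<delta>)"
      using W2_near_optimal[OF P2(1,2) \<delta>] by blast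
    obtain \<pi>2 where p2: "\<pi>2 \<in> couplings \<nu> \<xi>" and c2: "transport_cost \<pi>2 \<le> ennreal ((W2 \<nu> \<xi>)\<^sup>2 + \<delta>)"
      using W2_near_optimal[OF P2(2,3) \<delta>] by blast
    obtain \<sigma> where ss[measurable_cong]: "sets \<sigma> = sets ((borel \<Otimes>\<^sub>M borel) \<Otimes>\<^sub>M (borel \<Otimes>\<^sub>M borel))"
      and d1: "distr \<sigma> (borel \<Otimes>\<^sub>M borel) fst = \<pi>1" and d2: "distr \<sigma> (borel \<Otimes>\<^sub>M borel) snd = \<pi>2"
      and near: "AE w in \<sigma>. dist (snd (fst w)) (fst (snd w)) < \<delta>"
      using approx_gluing[OF pm(2) p1 p2 \<delta>] by blast
    have m1: "fst \<in> \<sigma> \<rightarrow>\<^sub>M (borel \<Otimes>\<^sub>M borel)" and m2: "snd \<in> \<sigma> \<rightarrow>\<^sub>M (borel \<Otimes>\<^sub>M borel)"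
      by measurable
    have "prob_space (distr \<sigma> (borel \<Otimes>\<^sub>M borel) fst)"
      unfolding d1 using couplings_prob[OF p1 pm(1)] .
    then interpret S: prob_space \<sigma> by (rule prob_space_distrD[OF m1])
    have aex: "AE w in \<sigma>. dist a (fst (fst w)) \<le> \<epsilon>"
      using AE_distrD[OF m1, of "\<lambda>z. dist a (fst z) \<le> \<epsilon>"] couplings_AE_fst[OF p1 A] unfolding d1 by blast
    have aey: "AE w in \<sigma>. dist b (snd (snd w)) \<le> R"
      using AE_distrD[OF m2, of "\<lambda>z. dist b (snd z) \<le> R"] couplings_AE_snd[OF p2 B] unfolding d2 by blast
    \<comment> \<open>Forgetting both middle points leaves a competitor between \<mu> and \<xi>,
      whose cost is at least w^2.\<close>
    define \<pi> where "\<pi> = distr \<sigma> (borel \<Otimes>\<^sub>M borel) (\<lambda>w. (fst (fst w), snd (snd w)))"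
    have "distr \<pi> borel fst = \<mu>"
      unfolding \<pi>_def couplings_fst[OF p1, symmetric] d1[symmetric]
      by (simp add: distr_distr comp_def)
    moreover have "distr \<pi> borel snd = \<xi>"
      unfolding \<pi>_def couplings_snd[OF p2, symmetric] d2[symmetric]
      by (simp add: distr_distr comp_def)
    ultimately have "\<pi> \<in> couplings \<mu> \<xi>" by (simp add: couplings_def \<pi>_def)
    from W2_le_cost[OF this] have low: "ennreal (w\<^sup>2) \<le> (\<integral>\<^sup>+ w. ennreal ((dist (fst (fst w)) (snd (snd w)))\<^sup>2) \<partial>\<sigma>)"
      unfolding transport_cost_def \<pi>_def w_def by (subst (asm) nn_integral_distr) auto
    have i1: "(\<integral>\<^sup>+ w. ennreal ((dist (fst (fst w)) (snd (fst w)))\<^sup>2) \<partial>\<sigma>) \<le> ennreal (t\<^sup>2 * w\<^sup>2 + \<delta>)"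
      using c1 unfolding transport_cost_def W w_def d1[symmetric]
      by (subst (asm) nn_integral_distr) (auto simp: power_mult_distrib)
    have i2: "(\<integral>\<^sup>+ w. ennreal ((dist (fst (snd w)) (snd (snd w)))\<^sup>2) \<partial>\<sigma>) \<le> ennreal ((1 - t)\<^sup>2 * w\<^sup>2 + \<delta>)"
      using c2 unfolding transport_cost_def W w_def d2[symmetric]
      by (subst (asm) nn_integral_distr) (auto simp: power_mult_distrib)
    have i3: "(\<integral>\<^sup>+ w. ennreal (\<eta>\<^sup>2 / t) * indicator E (snd (fst w)) \<partial>\<sigma>) = ennreal (\<eta>\<^sup>2 / t) * emeasure \<nu> E"
    proof -
      have "emeasure \<nu> E = (\<integral>\<^sup>+ z. indicator E z \<partial>\<nu>)" by (simp add: sm)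
      also have "\<dots> = (\<integral>\<^sup>+ w. indicator E (snd (fst w)) \<partial>\<sigma>)"
        unfolding couplings_snd[OF p1, symmetric] d1[symmetric]
        by (subst distr_distr, simp, simp, subst nn_integral_distr) (auto simp: comp_def)
      finally show ?thesis by (simp add: nn_integral_cmult)
    qed
    have "ennreal (w\<^sup>2) + ennreal (\<eta>\<^sup>2 / t) * emeasure \<nu> E \<le>
      (\<integral>\<^sup>+ w. ennreal ((dist (fst (fst w)) (snd (snd w)))\<^sup>2) + ennreal (\<eta>\<^sup>2 / t) * indicator E (snd (fst w)) \<partial>\<sigma>)"
      using low i3 by (subst nn_integral_add) (auto intro!: add_mono)
    also have "\<dots> \<le> (\<integral>\<^sup>+ w. ennreal (1 / t) * ennreal ((dist (fst (fst w)) (snd (fst w)))\<^sup>2)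
       + (ennreal (1 / (1 - t)) * ennreal ((dist (fst (snd w)) (snd (snd w)))\<^sup>2) + ennreal (2 * D * \<delta>)) \<partial>\<sigma>)"
    proof (rule nn_integral_mono_AE)
      show "AE w in \<sigma>. ennreal ((dist (fst (fst w)) (snd (snd w)))\<^sup>2) + ennreal (\<eta>\<^sup>2 / t) * indicator E (snd (fst w))
        \<le> ennreal (1 / t) * ennreal ((dist (fst (fst w)) (snd (fst w)))\<^sup>2)
       + (ennreal (1 / (1 - t)) * ennreal ((dist (fst (snd w)) (snd (snd w)))\<^sup>2) + ennreal (2 * D * \<delta>))"
        using aex aey near
      proof eventually_elim
        case (elim w)
        obtain x z z' y where w: "w = ((x, z), (z', y))" by (metis prod.collapse)
        have e: "dist a x \<le> \<epsilon>" "dist b y \<le> R" "dist z z' < \<delta>" using elim w by auto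
        have lD: "dist x y \<le> D"
          using e dist_triangle[of x y a] dist_triangle[of a y b] unfolding D_def by (simp add: dist_commute)
        have l3: "dist x y \<le> dist x z + dist z' y + \<delta>"
          using e dist_triangle[of x y z] dist_triangle[of z y z'] by simp
        have "(dist x y)\<^sup>2 + (dist x z - t * dist x y)\<^sup>2 / t \<le>
           (dist x z)\<^sup>2 / t + (dist z' y)\<^sup>2 / (1 - t) + 2 * D * \<delta>"
          by (rule intermediate_cost_bound) (use t lD l3 \<delta> in auto)
        \<comment> \<open>On \<open>E\<close> the point z is farther from x than t * d(x, y) by at
          least \<eta>, because x lies within \<epsilon> of a and d(x, y) \<le> D.\<close>
        moreover have "\<eta>\<^sup>2 / t * indicator E z \<le> (dist x z - t * dist x y)\<^sup>2 / t"
        proof (cases "z \<in> E")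
          case True
          have "dist a z \<le> \<epsilon> + dist x z" using e dist_triangle[of a z x] by simp
          moreover have "t * dist x y \<le> t * D" using lD t by simp
          ultimately have "\<eta> \<le> dist x z - t * dist x y" using True unfolding E_def by simp
          then show ?thesis using \<eta> t True by (auto intro!: divide_right_mono power_mono)
        qed (use t in simp)
        ultimately have *: "(dist x y)\<^sup>2 + \<eta>\<^sup>2 / t * indicator E z \<le>
           1 / t * (dist x z)\<^sup>2 + (1 / (1 - t) * (dist z' y)\<^sup>2 + 2 * D * \<delta>)"
          by simp
        have "ennreal ((dist x y)\<^sup>2) + ennreal (\<eta>\<^sup>2 / t) * indicator E z =
           ennreal ((dist x y)\<^sup>2 + \<eta>\<^sup>2 / t * indicator E z)"
          using t by (auto simp: indicator_def)
        also have "\<dots> \<le> ennreal (1 / t * (dist x z)\<^sup>2 + (1 / (1 - t) * (dist z' y)\<^sup>2 + 2 * D * \<delta>))"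
          by (rule ennreal_leI[OF *])
        also have "\<dots> = ennreal (1 / t) * ennreal ((dist x z)\<^sup>2) +
            (ennreal (1 / (1 - t)) * ennreal ((dist z' y)\<^sup>2) + ennreal (2 * D * \<delta>))"
          using t D0 \<delta> by (simp add: ennreal_mult[symmetric])
        finally show ?case using w by simp
      qed
    qed
    also have "\<dots> = ennreal (1 / t) * (\<integral>\<^sup>+ w. ennreal ((dist (fst (fst w)) (snd (fst w)))\<^sup>2) \<partial>\<sigma>) +
       (ennreal (1 / (1 - t)) * (\<integral>\<^sup>+ w. ennreal ((dist (fst (snd w)) (snd (snd w)))\<^sup>2) \<partial>\<sigma>) + ennreal (2 * D * \<delta>))"
      by (simp add: nn_integral_add nn_integral_cmult S.emeasure_space_1)
    also have "\<dots> \<le> ennreal (1 / t) * ennreal (t\<^sup>2 * w\<^sup>2 + \<delta>) +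
       (ennreal (1 / (1 - t)) * ennreal ((1 - t)\<^sup>2 * w\<^sup>2 + \<delta>) + ennreal (2 * D * \<delta>))"
      by (intro add_mono mult_left_mono i1 i2) auto
    also have "\<dots> = ennreal (1 / t * (t\<^sup>2 * w\<^sup>2 + \<delta>) + (1 / (1 - t) * ((1 - t)\<^sup>2 * w\<^sup>2 + \<delta>) + 2 * D * \<delta>))"
      using t D0 \<delta> by (simp add: ennreal_mult[symmetric] ennreal_plus[symmetric] del: ennreal_plus)
    also have "1 / t * (t\<^sup>2 * w\<^sup>2 + \<delta>) + (1 / (1 - t) * ((1 - t)\<^sup>2 * w\<^sup>2 + \<delta>) + 2 * D * \<delta>) =
       w\<^sup>2 + \<delta> * (1 / t + 1 / (1 - t) + 2 * D)"
      using t by (simp add: field_simps power2_eq_square)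
    finally have "ennreal (w\<^sup>2 + \<eta>\<^sup>2 / t * measure \<nu> E) \<le> ennreal (w\<^sup>2 + \<delta> * (1 / t + 1 / (1 - t) + 2 * D))"
      using t by (simp add: N.emeasure_eq_measure ennreal_mult[symmetric] ennreal_plus[symmetric] del: ennreal_plus)
    moreover have "0 \<le> w\<^sup>2 + \<delta> * (1 / t + 1 / (1 - t) + 2 * D)" using t D0 \<delta> by simp
    ultimately show ?thesis by (simp add: ennreal_le_iff mult.commute)
  qed
  have "measure \<nu> E = 0"
  proof (rule ccontr)
    assume "measure \<nu> E \<noteq> 0"
    then have pos: "measure \<nu> E * (\<eta>\<^sup>2 / t) > 0" using \<eta> t by (simp add: zero_less_measure_iff)
    define c where "c = 1 / t + 1 / (1 - t) + 2 * D"
    have c: "c > 0" unfolding c_def using t D0 by (simp add: add_pos_pos add_pos_nonneg)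
    \<comment> \<open>Chosen so that \<open>small\<close> bounds its left-hand side by half of
      itself.\<close>
    define \<delta> where "\<delta> = measure \<nu> E * (\<eta>\<^sup>2 / t) / (2 * c)"
    have "\<delta> > 0" unfolding \<delta>_def using pos c by (intro divide_pos_pos) auto
    from small[OF this] have "measure \<nu> E * (\<eta>\<^sup>2 / t) \<le> \<delta> * c" unfolding c_def .
    also have "\<dots> = measure \<nu> E * (\<eta>\<^sup>2 / t) / 2" unfolding \<delta>_def using c by simp
    finally show False using pos by simp
  qed
  then have "emeasure \<nu> E = 0" by (simp add: N.emeasure_eq_measure)
  then show ?thesis
    unfolding D_def[symmetric] by (intro AE_I[where N=E]) (auto simp: E_def sm)
qed


section \<open>Consequences of the curvature-dimension condition\<close>

lemma neg_root_measurable [measurable]: "neg_root N \<in> borel_measurable borel"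
  unfolding neg_root_def by measurable

text \<open>The tangent line of the concave function \<open>s powr (1 - 1 / N)\<close> at c, from
  Young's inequality with weights 1 - 1 / N and 1 / N. At r = 0 and r = \<infinity> the left-hand
  side is 0 * \<infinity> = 0.\<close>

lemma mult_neg_root_le:
  assumes N: "N > 1" and c: "c > 0"
  shows "r * neg_root N r \<le> ennreal ((1 - 1 / N) * c powr (- 1 / N)) * r + ennreal (1 / N * c powr (1 - 1 / N))"
proof (cases "r = 0 \<or> r = \<infinity>")
  case True
  then show ?thesis
    using N c by (auto simp: neg_root_def)
next
  case False
  then obtain s where s: "r = ennreal s" "s > 0"
    by (cases r) (auto simp: less_le)
  have "s * s powr (- 1 / N) = (s / c) powr (1 - 1 / N) * c powr (1 - 1 / N)"
    using s c by (simp add: powr_divide powr_diff powr_minus_divide)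
  also have "(s / c) powr (1 - 1 / N) \<le> 1 + (1 - 1 / N) * (s / c - 1)"
  proof -
    have "(s / c) powr (1 - 1 / N) * 1 powr (1 / N) \<le> (1 - 1 / N) * (s / c) + (1 / N) * 1"
      using N s c by (intro Youngs_inequality_0) auto
    then show ?thesis by (simp add: algebra_simps)
  qed
  then have "(s / c) powr (1 - 1 / N) * c powr (1 - 1 / N) \<le>
      (1 + (1 - 1 / N) * (s / c - 1)) * c powr (1 - 1 / N)"
    by (intro mult_right_mono) auto
  also have "\<dots> = (1 - 1 / N) * c powr (- 1 / N) * s + 1 / N * c powr (1 - 1 / N)"
  proof -
    have "c powr (1 - 1 / N) = c * c powr (- 1 / N)"
      using c by (simp add: powr_diff powr_minus_divide)
    then show ?thesis
      using c N by (simp add: field_simps)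
  qed
  finally have "ennreal (s * s powr (- 1 / N)) \<le>
      ennreal ((1 - 1 / N) * c powr (- 1 / N) * s + 1 / N * c powr (1 - 1 / N))"
    by (rule ennreal_leI)
  then show ?thesis
    using s N c by (simp add: neg_root_def ennreal_mult ennreal_plus)
qed

text \<open>\<open>RN_deriv\<close> with a null singular part shows that the choice in
  \<open>ac_density\<close> is not void. Domination by \<mu> is all that the entropy bound takes
  from the decomposition, so its uniqueness need not be discussed.\<close>

lemma ac_density_props:
  assumes "sigma_finite_measure m" "absolutely_continuous m \<mu>" "sets \<mu> = sets m"
  shows "ac_density m \<mu> \<in> borel_measurable m"
    and "\<And>A. A \<in> sets m \<Longrightarrow> emeasure (density m (ac_density m \<mu>)) A \<le> emeasure \<mu> A"
proof -
  let ?P = "\<lambda>\<rho>. \<rho> \<in> borel_measurable m \<and>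
        (\<exists>\<nu>. sets \<nu> = sets m \<and> singular_measures \<nu> m \<and>
             (\<forall>A\<in>sets m. emeasure \<mu> A = emeasure (density m \<rho>) A + emeasure \<nu> A))"
  have "?P (RN_deriv m \<mu>)"
  proof (intro conjI exI[of _ "null_measure m"] ballI)
    show "singular_measures (null_measure m) m"
      unfolding singular_measures_def by (intro bexI[of _ "{}"]) auto
    show "emeasure \<mu> A = emeasure (density m (RN_deriv m \<mu>)) A + emeasure (null_measure m) A"
      if "A \<in> sets m" for A
      using sigma_finite_measure.density_RN_deriv[OF assms] that by simp
  qed auto
  then have *: "?P (ac_density m \<mu>)"
    unfolding ac_density_def by (rule someI[of ?P])
  show "ac_density m \<mu> \<in> borel_measurable m" using * by blast
  show "emeasure (density m (ac_density m \<mu>)) A \<le> emeasure \<mu> A" if "A \<in> sets m" for A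
    using * that by (metis le_add1 le_iff_add)
qed

text \<open>Jensen's inequality, by integrating the tangent line at 1 / m(E). This is the density of
  the uniform measure on E, for which equality holds; hence the coefficients satisfy a + b * M =
  M^(1 / N).\<close>

lemma renyi_integral_le:
  assumes sf: "sigma_finite_measure m" and ac: "absolutely_continuous m \<mu>" and s: "sets \<mu> = sets m"
    and prob: "prob_space \<mu>" and E[measurable]: "E \<in> sets m" and c: "AE x in \<mu>. x \<in> E"
    and fin: "emeasure m E < \<infinity>" and pos: "0 < measure m E" and N: "N > 1"
  shows "(\<integral>\<^sup>+ x. neg_root N (ac_density m \<mu> x) \<partial>(density m (ac_density m \<mu>)))
    \<le> ennreal (measure m E powr (1 / N))"
proof -
  define \<rho> where "\<rho> = ac_density m \<mu>"
  have \<rho>[measurable]: "\<rho> \<in> borel_measurable m"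
    and le: "\<And>A. A \<in> sets m \<Longrightarrow> emeasure (density m \<rho>) A \<le> emeasure \<mu> A"
    unfolding \<rho>_def using ac_density_props[OF sf ac s] by auto
  interpret prob_space \<mu> by fact
  have sp: "space \<mu> = space m" using s by (rule sets_eq_imp_space_eq)
  have "emeasure \<mu> (space m - E) = 0"
    using c AE_iff_measurable[of "space m - E" \<mu> "\<lambda>x. x \<in> E"] by (auto simp: sp s set_diff_eq)
  then have "emeasure (density m \<rho>) (space m - E) = 0"
    using le[of "space m - E"] by simp
  then have "AE x in density m \<rho>. x \<in> E"
    by (intro AE_I[where N="space m - E"]) auto
  then have ae: "AE x in m. 0 < \<rho> x \<longrightarrow> x \<in> E"
    by (subst (asm) AE_density) auto
  have tot: "(\<integral>\<^sup>+ x. \<rho> x \<partial>m) \<le> 1"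
  proof -
    have "(\<integral>\<^sup>+ x. \<rho> x \<partial>m) = emeasure (density m \<rho>) (space m)"
      by (subst emeasure_density) (auto intro!: nn_integral_cong)
    also have "\<dots> \<le> emeasure \<mu> (space m)" by (rule le) simp
    also have "\<dots> = 1" using emeasure_space_1 sp by simp
    finally show ?thesis .
  qed
  define M where "M = measure m E"
  have M: "M > 0" and eM: "emeasure m E = ennreal M"
    unfolding M_def using pos fin by (auto simp: emeasure_eq_ennreal_measure)
  define a b where "a = (1 - 1 / N) * (1 / M) powr (- 1 / N)" and "b = 1 / N * (1 / M) powr (1 - 1 / N)"
  have ab: "a \<ge> 0" "b \<ge> 0" unfolding a_def b_def using N by auto
  have "(\<integral>\<^sup>+ x. neg_root N (\<rho> x) \<partial>(density m \<rho>)) = (\<integral>\<^sup>+ x. \<rho> x * neg_root N (\<rho> x) \<partial>m)"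
    by (subst nn_integral_density) auto
  also have "\<dots> \<le> (\<integral>\<^sup>+ x. ennreal a * \<rho> x + ennreal b * indicator E x \<partial>m)"
  proof (rule nn_integral_mono_AE)
    show "AE x in m. \<rho> x * neg_root N (\<rho> x) \<le> ennreal a * \<rho> x + ennreal b * indicator E x"
      using ae
    proof eventually_elim
      case (elim x)
      show ?case
      proof (cases "\<rho> x = 0")
        case False
        then have "x \<in> E" using elim by (simp add: zero_less_iff_neq_zero)
        then show ?thesis
          using mult_neg_root_le[OF N, of "1 / M" "\<rho> x"] M unfolding a_def b_def by simp
      qed simp
    qed
  qed
  also have "\<dots> = ennreal a * (\<integral>\<^sup>+ x. \<rho> x \<partial>m) + ennreal b * ennreal M"
    by (simp add: nn_integral_add nn_integral_cmult nn_integral_cmult_indicator eM)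
  also have "\<dots> \<le> ennreal a * 1 + ennreal b * ennreal M"
    by (intro add_mono mult_left_mono tot) auto
  also have "\<dots> = ennreal (a + b * M)"
    using ab M by (simp add: ennreal_mult)
  also have "a + b * M = M powr (1 / N)"
  proof -
    have "(1 / M) powr (- 1 / N) = M powr (1 / N)" "(1 / M) powr (1 - 1 / N) = M powr (1 / N) / M"
      using M by (simp_all add: powr_divide powr_diff powr_minus_divide)
    then show ?thesis
      unfolding a_def b_def using M N by (simp add: algebra_simps)
  qed
  finally show ?thesis unfolding \<rho>_def M_def .
qed

section \<open>Uniform measures\<close>

lemma uniform_measure_P2_ac:
  fixes m :: "'a::polish_space measure"
  assumes m: "sets m = sets borel" and A: "A \<in> sets borel" "bounded A"
    and fin: "emeasure m A < \<infinity>" and pos: "emeasure m A > 0"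
  shows "uniform_measure m A \<in> P2_ac m"
proof -
  have prob: "prob_space (uniform_measure m A)"
    using fin pos by (intro prob_space_uniform_measure) auto
  have ae: "AE x in uniform_measure m A. x \<in> A"
    using fin pos A m by (intro AE_uniform_measureI) auto
  obtain z e where ze: "\<And>y. y \<in> A \<Longrightarrow> dist z y \<le> e"
    using A(2) unfolding bounded_def by blast
  interpret prob_space "uniform_measure m A" by fact
  have "(\<integral>\<^sup>+ x. ennreal ((dist z x)\<^sup>2) \<partial>uniform_measure m A) \<le> (\<integral>\<^sup>+ x. ennreal (e\<^sup>2) \<partial>uniform_measure m A)"
    using ae by (intro nn_integral_mono_AE, eventually_elim) (auto intro!: power_mono ze)
  also have "\<dots> < \<infinity>" using emeasure_space_1 by simp
  finally have "uniform_measure m A \<in> P2"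
    unfolding P2_def using prob m by auto
  moreover have "absolutely_continuous m (uniform_measure m A)"
    unfolding uniform_measure_def by (rule absolutely_continuousI_density) (use A m in auto)
  ultimately show ?thesis by (simp add: P2_ac_def)
qed

text \<open>The derivative is determined only up to m-null sets. The uniform measure ignores these,
  as well as the complement of A, where the density vanishes and \<open>neg_root\<close> is
  infinite.\<close>

lemma neg_root_RN_deriv_uniform:
  fixes m :: "'a::polish_space measure"
  assumes sf: "sigma_finite_measure m" and m: "sets m = sets borel" and A: "A \<in> sets borel"
    and fin: "emeasure m A < \<infinity>" and pos: "emeasure m A > 0"
  shows "AE x in uniform_measure m A.
    neg_root N (RN_deriv m (uniform_measure m A) x) = ennreal (measure m A powr (1 / N))"
proof -
  have M: "emeasure m A = ennreal (measure m A)" "measure m A > 0"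
    using fin pos by (auto simp: emeasure_eq_ennreal_measure zero_less_measure_iff)
  have "AE x in m. indicator A x / emeasure m A = RN_deriv m (uniform_measure m A) x"
    using A m by (intro sigma_finite_measure.RN_deriv_unique[OF sf]) (auto simp: uniform_measure_def)
  moreover have "absolutely_continuous m (uniform_measure m A)"
    unfolding uniform_measure_def by (rule absolutely_continuousI_density) (use A m in auto)
  ultimately have 1: "AE x in uniform_measure m A. indicator A x / emeasure m A = RN_deriv m (uniform_measure m A) x"
    by (intro absolutely_continuous_AE[of "uniform_measure m A" m]) auto
  have 2: "AE x in uniform_measure m A. x \<in> A"
    using fin pos A m by (intro AE_uniform_measureI) auto
  from 1 2 show ?thesis
  proof eventually_elim
    case (elim x)
    then have "RN_deriv m (uniform_measure m A) x = ennreal (1 / measure m A)"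
      using M by (simp add: divide_ennreal flip: ennreal_1)
    then show ?case
      using M by (simp add: neg_root_def powr_divide powr_minus_divide)
  qed
qed

section \<open>Finiteness and positivity of ball volumes in proper spaces\<close>

locale proper_mm_space =
  fixes m :: "'a::polish_space measure"
  assumes mms: "metric_measure_space m" and proper: "proper_space TYPE('a)"
begin

lemma sets_m [measurable_cong]: "sets m = sets borel"
  using mms by (simp add: metric_measure_space_def)

lemma space_m [simp]: "space m = UNIV"
  using sets_eq_imp_space_eq[OF sets_m] by simp

lemma emeasure_compact_finite:
  assumes "compact S"
  shows "emeasure m S < \<infinity>"
proof -
  have "\<forall>x. \<exists>U. open U \<and> x \<in> U \<and> emeasure m U < \<infinity>"
    using mms by (simp add: metric_measure_space_def locally_finite_measure_def)
  then obtain U where U: "\<And>x. open (U x)" "\<And>x. x \<in> U x" "\<And>x. emeasure m (U x) < \<infinity>"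
    unfolding choice_iff by blast
  have "S \<subseteq> (\<Union>x\<in>UNIV. U x)" using U(2) by auto
  then obtain T where T: "finite T" "S \<subseteq> (\<Union>x\<in>T. U x)"
    using compactE_image[OF assms, of UNIV U] U(1) by metis
  have Um: "U x \<in> sets m" for x using U(1) by (simp add: sets_m)
  have "emeasure m S \<le> emeasure m (\<Union>x\<in>T. U x)"
    using T Um by (intro emeasure_mono) auto
  also have "\<dots> \<le> (\<Sum>x\<in>T. emeasure m (U x))"
    using T Um by (intro emeasure_subadditive_finite) auto
  also have "\<dots> < \<infinity>" using T(1) U(3) by simp
  finally show ?thesis .
qed

lemma emeasure_bounded_finite:
  assumes "bounded S"
  shows "emeasure m S < \<infinity>"
proof -
  have "compact (closure S)"
    using proper assms unfolding proper_space_def by (simp add: bounded_closure)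
  then have "emeasure m (closure S) < \<infinity>" by (rule emeasure_compact_finite)
  moreover have "emeasure m S \<le> emeasure m (closure S)"
    by (intro emeasure_mono closure_subset) (simp add: sets_m)
  ultimately show ?thesis by (rule le_less_trans[rotated])
qed

lemma emeasure_ball_pos: "r > 0 \<Longrightarrow> emeasure m (ball x r) > 0"
proof -
  assume "r > 0"
  moreover have "x \<in> measure_support m" using mms by (simp add: metric_measure_space_def)
  ultimately show ?thesis unfolding measure_support_def by simp
qed

lemma emeasure_bounded:
  "bounded S \<Longrightarrow> emeasure m S = ennreal (measure m S)"
  using emeasure_bounded_finite[of S] by (simp add: emeasure_eq_ennreal_measure)

lemma measure_ball_pos: "r > 0 \<Longrightarrow> measure m (ball x r) > 0"
  using emeasure_ball_pos[of r x] emeasure_bounded[of "ball x r"] by simp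

lemma measure_mono_bounded:
  assumes "A \<subseteq> B" "bounded B" "B \<in> sets borel"
  shows "measure m A \<le> measure m B"
proof -
  have "B \<in> sets m" using assms(3) by (simp add: sets_m)
  then have "emeasure m A \<le> emeasure m B" using assms(1) by (rule emeasure_mono[rotated])
  moreover have "emeasure m B < top" using emeasure_bounded_finite[OF assms(2)] by simp
  ultimately show ?thesis unfolding measure_def by (rule enn2real_mono)
qed

lemma sigma_finite_m: "sigma_finite_measure m"
proof
  let ?A = "range (\<lambda>k::nat. ball undefined (real k))"
  have "(\<Union>?A) = UNIV"
    using reals_Archimedean2 by auto
  then show "\<exists>A. countable A \<and> A \<subseteq> sets m \<and> \<Union>A = space m \<and> (\<forall>a\<in>A. emeasure m a \<noteq> \<infinity>)"
    using emeasure_bounded_finite[OF bounded_ball]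
    by (intro exI[of _ ?A]) (auto simp: sets_m less_top)
qed

end

section \<open>A Brunn-Minkowski inequality for balls and its consequences\<close>

locale cd_space = proper_mm_space +
  fixes K N :: real
  assumes cd: "CD K N m" and N: "N > 1"
begin

text \<open>Of the transport data only one coupling remains: the entropy of the intermediate measure
  is controlled by the volume of a ball that carries it, and the densities of the end measures are
  constants. In the applications \<open>tau\<close> is constant at the distances that occur, so the
  marginals of \<pi> suffice.\<close>

lemma CD_balls:
  assumes e: "\<epsilon> > 0" and R: "R > 0" and t: "0 < t" "t < 1" and \<eta>: "\<eta> > 0"
  obtains \<pi> where "\<pi> \<in> couplings (uniform_measure m (ball a \<epsilon>)) (uniform_measure m (ball b R))"
    "(\<integral>\<^sup>+ z. tau K N (1 - t) (dist (fst z) (snd z)) * ennreal (measure m (ball a \<epsilon>) powr (1 / N))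
        + tau K N t (dist (fst z) (snd z)) * ennreal (measure m (ball b R) powr (1 / N)) \<partial>\<pi>)
     \<le> ennreal (measure m (cball a (\<epsilon> + t * (dist a b + \<epsilon> + R) + \<eta>)) powr (1 / N))"
proof -
  let ?\<mu> = "uniform_measure m (ball a \<epsilon>)" and ?\<nu> = "uniform_measure m (ball b R)"
  have ac: "?\<mu> \<in> P2_ac m" "?\<nu> \<in> P2_ac m"
    using emeasure_bounded_finite[OF bounded_ball] emeasure_ball_pos e R
    by (auto intro!: uniform_measure_P2_ac sets_m)
  from cd ac obtain \<pi> \<Gamma> where pi: "optimal_coupling ?\<mu> ?\<nu> \<pi>" and G: "geodesic_in_P2_ac m \<Gamma> ?\<mu> ?\<nu>"
    and all: "\<forall>t\<in>{0..1}. \<forall>N'\<ge>N. renyi_entropy N' (\<Gamma> t) m \<le>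
               - enn2ereal (\<integral>\<^sup>+ z.
                   tau K N' (1 - t) (dist (fst z) (snd z)) * neg_root N' (RN_deriv m ?\<mu> (fst z))
                 + tau K N' t (dist (fst z) (snd z)) * neg_root N' (RN_deriv m ?\<nu> (snd z)) \<partial>\<pi>)"
    unfolding CD_def by blast
  have le: "renyi_entropy N (\<Gamma> t) m \<le>
               - enn2ereal (\<integral>\<^sup>+ z.
                   tau K N (1 - t) (dist (fst z) (snd z)) * neg_root N (RN_deriv m ?\<mu> (fst z))
                 + tau K N t (dist (fst z) (snd z)) * neg_root N (RN_deriv m ?\<nu> (snd z)) \<partial>\<pi>)"
    using bspec[OF all, of t] t by simp
  have pc: "\<pi> \<in> couplings ?\<mu> ?\<nu>" using pi by (simp add: optimal_coupling_def)
  have Gt: "\<Gamma> t \<in> P2_ac m" and W: "W2 ?\<mu> (\<Gamma> t) = t * W2 ?\<mu> ?\<nu>" "W2 (\<Gamma> t) ?\<nu> = (1 - t) * W2 ?\<mu> ?\<nu>"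
  proof -
    have *: "\<And>s t. s \<in> {0..1} \<Longrightarrow> t \<in> {0..1} \<Longrightarrow> W2 (\<Gamma> s) (\<Gamma> t) = \<bar>s - t\<bar> * W2 ?\<mu> ?\<nu>" "\<Gamma> 0 = ?\<mu>" "\<Gamma> 1 = ?\<nu>"
      using G by (auto simp: geodesic_in_P2_ac_def)
    show "\<Gamma> t \<in> P2_ac m" using G t by (auto simp: geodesic_in_P2_ac_def)
    show "W2 ?\<mu> (\<Gamma> t) = t * W2 ?\<mu> ?\<nu>" using *(1)[of 0 t] t *(2,3) by simp
    show "W2 (\<Gamma> t) ?\<nu> = (1 - t) * W2 ?\<mu> ?\<nu>" using *(1)[of t 1] t *(2,3) by simp
  qed
  define E where "E = cball a (\<epsilon> + t * (dist a b + \<epsilon> + R) + \<eta>)"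
  have P2: "?\<mu> \<in> P2" "\<Gamma> t \<in> P2" "?\<nu> \<in> P2" using ac Gt by (auto simp: P2_ac_def)
  have u: "AE x in uniform_measure m (ball c r). dist c x \<le> r" if "r > 0" for c r
    using emeasure_bounded_finite[OF bounded_ball, of c r] emeasure_ball_pos[OF that, of c]
    by (intro AE_uniform_measureI) (auto simp: sets_m)
  have conc: "AE z in \<Gamma> t. dist a z \<le> \<epsilon> + t * (dist a b + \<epsilon> + R) + \<eta>"
    using e R by (intro intermediate_measure_concentrated[OF P2 u u t W _ _ \<eta>]) auto
  have Esub: "ball a \<epsilon> \<subseteq> E"
  proof -
    have "0 \<le> t * (dist a b + \<epsilon> + R)" using e R t by simp
    then show ?thesis unfolding E_def using \<eta> by auto
  qed
  have Epos: "measure m E > 0"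
    using measure_ball_pos[OF e, of a] measure_mono_bounded[OF Esub] unfolding E_def by fastforce
  have "(\<integral>\<^sup>+ x. neg_root N (ac_density m (\<Gamma> t) x) \<partial>(density m (ac_density m (\<Gamma> t))))
    \<le> ennreal (measure m E powr (1 / N))"
  proof (rule renyi_integral_le[OF sigma_finite_m])
    show "AE x in \<Gamma> t. x \<in> E" using conc by (simp add: E_def)
    show "emeasure m E < \<infinity>" unfolding E_def by (rule emeasure_bounded_finite) simp
  qed (use Gt Epos N in \<open>auto simp: P2_ac_def P2_def sets_m E_def\<close>)
  moreover have "(\<integral>\<^sup>+ z.
                   tau K N (1 - t) (dist (fst z) (snd z)) * neg_root N (RN_deriv m ?\<mu> (fst z))
                 + tau K N t (dist (fst z) (snd z)) * neg_root N (RN_deriv m ?\<nu> (snd z)) \<partial>\<pi>)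
       \<le> (\<integral>\<^sup>+ x. neg_root N (ac_density m (\<Gamma> t) x) \<partial>(density m (ac_density m (\<Gamma> t))))"
    using le unfolding renyi_entropy_def by (simp add: less_eq_ennreal.rep_eq)
  moreover have "(\<integral>\<^sup>+ z.
                   tau K N (1 - t) (dist (fst z) (snd z)) * neg_root N (RN_deriv m ?\<mu> (fst z))
                 + tau K N t (dist (fst z) (snd z)) * neg_root N (RN_deriv m ?\<nu> (snd z)) \<partial>\<pi>) =
     (\<integral>\<^sup>+ z. tau K N (1 - t) (dist (fst z) (snd z)) * ennreal (measure m (ball a \<epsilon>) powr (1 / N))
        + tau K N t (dist (fst z) (snd z)) * ennreal (measure m (ball b R) powr (1 / N)) \<partial>\<pi>)"
  proof (rule nn_integral_cong_AE)
    have n: "AE x in uniform_measure m (ball c r).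
      neg_root N (RN_deriv m (uniform_measure m (ball c r)) x) = ennreal (measure m (ball c r) powr (1 / N))"
      if "r > 0" for c r
      using emeasure_bounded_finite[OF bounded_ball] emeasure_ball_pos[OF that]
      by (intro neg_root_RN_deriv_uniform sigma_finite_m sets_m) auto
    show "AE z in \<pi>.  tau K N (1 - t) (dist (fst z) (snd z)) * neg_root N (RN_deriv m ?\<mu> (fst z))
                 + tau K N t (dist (fst z) (snd z)) * neg_root N (RN_deriv m ?\<nu> (snd z)) =
        tau K N (1 - t) (dist (fst z) (snd z)) * ennreal (measure m (ball a \<epsilon>) powr (1 / N))
        + tau K N t (dist (fst z) (snd z)) * ennreal (measure m (ball b R) powr (1 / N))"
      using couplings_AE_fst[OF pc n[OF e]] couplings_AE_snd[OF pc n[OF R]]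
      by eventually_elim simp
  qed
  ultimately show ?thesis using that[OF pc] unfolding E_def by simp
qed

lemma bonnet_myers:
  assumes K: "K > 0"
  shows "dist (a :: 'a) b \<le> pi * sqrt ((N - 1) / K)"
proof (rule ccontr)
  define D where "D = pi * sqrt ((N - 1) / K)"
  assume "\<not> ?thesis"
  then have "dist a b > D" unfolding D_def by simp
  \<comment> \<open>Half of the excess: points of the two \<epsilon>-balls still have distance at
    least D, where \<open>tau\<close> is infinite.\<close>
  define \<epsilon> where "\<epsilon> = (dist a b - D) / 2"
  have e: "\<epsilon> > 0" using \<open>dist a b > D\<close> by (simp add: \<epsilon>_def)
  have Dpos: "D > 0" unfolding D_def using K N by simp
  obtain \<pi> where pc: "\<pi> \<in> couplings (uniform_measure m (ball a \<epsilon>)) (uniform_measure m (ball b \<epsilon>))"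
    and le: "(\<integral>\<^sup>+ z. tau K N (1 - 1/2) (dist (fst z) (snd z)) * ennreal (measure m (ball a \<epsilon>) powr (1 / N))
        + tau K N (1/2) (dist (fst z) (snd z)) * ennreal (measure m (ball b \<epsilon>) powr (1 / N)) \<partial>\<pi>)
     \<le> ennreal (measure m (cball a (\<epsilon> + 1/2 * (dist a b + \<epsilon> + \<epsilon>) + 1)) powr (1 / N))"
    by (rule CD_balls[OF e e, of "1/2" 1 a b]) (simp, simp, simp, assumption)
  have u: "AE x in uniform_measure m (ball c \<epsilon>). dist c x < \<epsilon>" for c
    using emeasure_bounded_finite[OF bounded_ball, of c \<epsilon>] emeasure_ball_pos[OF e, of c]
    by (intro AE_uniform_measureI) (auto simp: sets_m)
  have prob: "prob_space \<pi>"
    using emeasure_bounded_finite[OF bounded_ball, of a \<epsilon>] emeasure_ball_pos[OF e, of a]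
    by (intro couplings_prob[OF pc] prob_space_uniform_measure) auto
  interpret prob_space \<pi> by fact
  have "(\<integral>\<^sup>+ z. \<infinity> \<partial>\<pi>) = (\<integral>\<^sup>+ z. tau K N (1 - 1/2) (dist (fst z) (snd z)) * ennreal (measure m (ball a \<epsilon>) powr (1 / N))
        + tau K N (1/2) (dist (fst z) (snd z)) * ennreal (measure m (ball b \<epsilon>) powr (1 / N)) \<partial>\<pi>)"
  proof (rule nn_integral_cong_AE)
    show "AE z in \<pi>. \<infinity> = tau K N (1 - 1/2) (dist (fst z) (snd z)) * ennreal (measure m (ball a \<epsilon>) powr (1 / N))
        + tau K N (1/2) (dist (fst z) (snd z)) * ennreal (measure m (ball b \<epsilon>) powr (1 / N))"
      using couplings_AE_fst[OF pc u[of a]] couplings_AE_snd[OF pc u[of b]]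
    proof eventually_elim
      case (elim z)
      have "D \<le> dist (fst z) (snd z)"
        using elim dist_triangle[of a b "fst z"] dist_triangle[of "fst z" b "snd z"]
        unfolding \<epsilon>_def by (simp add: dist_commute)
      then have "D\<^sup>2 \<le> (dist (fst z) (snd z))\<^sup>2" using Dpos by (intro power_mono) auto
      moreover have "D\<^sup>2 = pi\<^sup>2 * ((N - 1) / K)"
        unfolding D_def using K N by (simp add: power_mult_distrib)
      ultimately have "(N - 1) * pi\<^sup>2 \<le> K * (dist (fst z) (snd z))\<^sup>2"
        using K by (simp add: field_simps)
      \<comment> \<open>\<open>tau\<close> tests for the value 0 first, so the infinite branch is
        reached only at positive distance.\<close>
      moreover have "K * (dist (fst z) (snd z))\<^sup>2 \<noteq> 0"
        using K Dpos \<open>D \<le> dist (fst z) (snd z)\<close> by auto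
      ultimately have "tau K N s (dist (fst z) (snd z)) = \<infinity>" for s by (simp add: tau_def)
      then show ?case
        using measure_ball_pos[OF e, of a] by (simp add: ennreal_top_mult)
    qed
  qed
  also have "\<dots> < \<infinity>" using le by (rule le_less_trans) simp
  finally show False using emeasure_space_1 by simp
qed

lemma compact_UNIV:
  assumes "K > 0"
  shows "compact (UNIV :: 'a set)"
proof -
  have "bounded (UNIV :: 'a set)"
    unfolding bounded_def using bonnet_myers[OF assms] by blast
  then show ?thesis using proper unfolding proper_space_def by auto
qed

lemma bishop_gromov_strict:
  assumes K: "K = 0" and t: "0 < t" "t < s" "s < 1" and R: "R > 0"
  shows "t powr N * measure m (ball x R) \<le> measure m (ball x (s * R))"
proof -
  \<comment> \<open>The intermediate ball has radius at most t * R + 3 * \<epsilon>, and 6 *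
    \<epsilon> = (s - t) * R keeps this strictly below s * R.\<close>
  define \<epsilon> where "\<epsilon> = (s - t) * R / 6"
  have e: "\<epsilon> > 0" unfolding \<epsilon>_def using t R by simp
  obtain \<pi> where pc: "\<pi> \<in> couplings (uniform_measure m (ball x \<epsilon>)) (uniform_measure m (ball x R))"
    and le: "(\<integral>\<^sup>+ z. tau K N (1 - t) (dist (fst z) (snd z)) * ennreal (measure m (ball x \<epsilon>) powr (1 / N))
        + tau K N t (dist (fst z) (snd z)) * ennreal (measure m (ball x R) powr (1 / N)) \<partial>\<pi>)
     \<le> ennreal (measure m (cball x (\<epsilon> + t * (dist x x + \<epsilon> + R) + \<epsilon>)) powr (1 / N))"
    by (rule CD_balls[OF e R t(1) less_trans[OF t(2,3)] e, of x x])
  have prob: "prob_space \<pi>"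
    using emeasure_bounded_finite[OF bounded_ball, of x \<epsilon>] emeasure_ball_pos[OF e, of x]
    by (intro couplings_prob[OF pc] prob_space_uniform_measure) auto
  interpret prob_space \<pi> by fact
  have "ennreal (t * measure m (ball x R) powr (1 / N)) =
      (\<integral>\<^sup>+ z. ennreal (t * measure m (ball x R) powr (1 / N)) \<partial>\<pi>)"
    using emeasure_space_1 by simp
  \<comment> \<open>For K = 0 the coefficient \<open>tau\<close> equals t at every distance, so the
    integrand dominates a constant. The small ball merely stands in for the point x, and its term is
    discarded.\<close>
  also have "\<dots> \<le> (\<integral>\<^sup>+ z. tau K N (1 - t) (dist (fst z) (snd z)) * ennreal (measure m (ball x \<epsilon>) powr (1 / N))
        + tau K N t (dist (fst z) (snd z)) * ennreal (measure m (ball x R) powr (1 / N)) \<partial>\<pi>)"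
    using t by (intro nn_integral_mono) (simp add: tau_def K ennreal_mult)
  also note le
  finally have "t * measure m (ball x R) powr (1 / N) \<le>
      measure m (cball x (\<epsilon> + t * (dist x x + \<epsilon> + R) + \<epsilon>)) powr (1 / N)"
    by (simp add: ennreal_le_iff)
  also have "\<dots> \<le> measure m (ball x (s * R)) powr (1 / N)"
  proof (intro powr_mono2 measure_mono_bounded)
    have "t * \<epsilon> \<le> 1 * \<epsilon>" using t e by (intro mult_right_mono) auto
    moreover have "6 * \<epsilon> = s * R - t * R" by (simp add: \<epsilon>_def left_diff_distrib)
    moreover have "t * (dist x x + \<epsilon> + R) = t * \<epsilon> + t * R" by (simp add: distrib_left)
    ultimately have "\<epsilon> + t * (dist x x + \<epsilon> + R) + \<epsilon> < s * R"
      using e by linarith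
    then show "cball x (\<epsilon> + t * (dist x x + \<epsilon> + R) + \<epsilon>) \<subseteq> ball x (s * R)"
      by (auto simp: subset_iff)
  qed (use N in auto)
  finally have "(t * measure m (ball x R) powr (1 / N)) powr N \<le> (measure m (ball x (s * R)) powr (1 / N)) powr N"
    using t N by (intro powr_mono2) auto
  then show ?thesis
    using N t by (simp add: powr_mult powr_powr)
qed

text \<open>The slight enlargement of the supporting ball gives only strict ratios at first; by
  continuity of the power, t may tend to r / R from below.\<close>

lemma bishop_gromov:
  assumes K: "K = 0" and r: "0 < r" "r \<le> R"
  shows "(r / R) powr N * measure m (ball x R) \<le> measure m (ball x r)"
proof (cases "r = R")
  case False
  define s where "s = r / R"
  have s: "0 < s" "s < 1" unfolding s_def using r False by auto
  have "((\<lambda>t. t powr N * measure m (ball x R)) \<longlongrightarrow> s powr N * measure m (ball x R)) (at_left s)"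
    using s by (intro tendsto_intros) auto
  moreover have "eventually (\<lambda>t. t powr N * measure m (ball x R) \<le> measure m (ball x r)) (at_left s)"
    using eventually_at_left_real[OF s(1)]
  proof eventually_elim
    case (elim t)
    then show ?case
      using bishop_gromov_strict[OF K, of t s R x] s r by (simp add: s_def)
  qed
  ultimately show ?thesis
    unfolding s_def by (intro tendsto_upperbound) (auto simp: trivial_limit_at_left_real)
qed (use r in simp)

end


section \<open>Laplace-type integrals of the distance\<close>

text \<open>Written over an open ray, so that the level sets \<open>D x < s\<close> in
  \<open>layer_cake\<close> are open balls.\<close>

lemma nn_integral_exponential_tail:
  fixes a l :: real
  assumes "l > 0"
  shows "(\<integral>\<^sup>+ s. ennreal (l * exp (- l * s)) * indicator {a<..} s \<partial>lborel) = ennreal (exp (- l * a))"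
proof -
  have lim: "((\<lambda>s. - exp (- l * s)) \<longlongrightarrow> 0) at_top"
    using assms by real_asymp
  have "(\<integral>\<^sup>+ s. ennreal (l * exp (- l * s)) * indicator {a<..} s \<partial>lborel) =
      (\<integral>\<^sup>+ s. ennreal (l * exp (- l * s)) * indicator {a..} s \<partial>lborel)"
    using AE_lborel_singleton[of a]
    by (intro nn_integral_cong_AE, eventually_elim) (auto simp: indicator_def)
  also have "\<dots> = ennreal (0 - (- exp (- l * a)))"
    using assms by (intro nn_integral_FTC_atLeast lim) (auto intro!: derivative_eq_intros)
  finally show ?thesis by simp
qed

text \<open>The moment of order k of the exponential law of rate l, from the Gamma integral by
  scaling. Through \<open>layer_cake\<close> it evaluates volumes that grow like a power of the
  radius.\<close>

lemma nn_integral_powr_exponential: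
  fixes k l :: real
  assumes l: "l > 0" and k: "k > -1"
  shows "(\<integral>\<^sup>+ s. ennreal (s powr k * (l * exp (- l * s))) * indicator {0..} s \<partial>lborel)
    = ennreal (l powr (- k) * Gamma (k + 1))"
proof -
  have "ennreal (Gamma (k + 1)) = (\<integral>\<^sup>+ t. ennreal (indicator {0..} t * t powr k / exp t) \<partial>lborel)"
    using Gamma_conv_nn_integral_real[of "k + 1"] k by simp
  also have "\<dots> = ennreal \<bar>l\<bar> * (\<integral>\<^sup>+ t. ennreal (indicator {0..} (0 + l * t) * (0 + l * t) powr k / exp (0 + l * t)) \<partial>lborel)"
    using l by (intro nn_integral_real_affine) auto
  also have "\<dots> = (\<integral>\<^sup>+ t. ennreal l * ennreal (indicator {0..} (l * t) * (l * t) powr k / exp (l * t)) \<partial>lborel)"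
    using l by (subst nn_integral_cmult) auto
  also have "\<dots> = (\<integral>\<^sup>+ t. ennreal (l powr k) * (ennreal (t powr k * (l * exp (- l * t))) * indicator {0..} t) \<partial>lborel)"
  proof (rule nn_integral_cong)
    fix t :: real
    show "ennreal l * ennreal (indicator {0..} (l * t) * (l * t) powr k / exp (l * t)) =
        ennreal (l powr k) * (ennreal (t powr k * (l * exp (- l * t))) * indicator {0..} t)"
    proof (cases "t \<ge> 0")
      case True
      then have "l * ((l * t) powr k / exp (l * t)) = l powr k * (t powr k * (l * exp (- l * t)))"
        using l by (simp add: powr_mult exp_minus field_simps)
      then show ?thesis using l True by (simp flip: ennreal_mult)
    qed (use l in \<open>simp add: zero_le_mult_iff\<close>)
  qed
  also have "\<dots> = ennreal (l powr k) *
      (\<integral>\<^sup>+ t. ennreal (t powr k * (l * exp (- l * t))) * indicator {0..} t \<partial>lborel)"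
    by (subst nn_integral_cmult) auto
  finally have "ennreal (l powr (- k)) * ennreal (Gamma (k + 1)) = ennreal (l powr (- k)) * (ennreal (l powr k) *
      (\<integral>\<^sup>+ t. ennreal (t powr k * (l * exp (- l * t))) * indicator {0..} t \<partial>lborel))"
    by simp
  also have "\<dots> = (\<integral>\<^sup>+ t. ennreal (t powr k * (l * exp (- l * t))) * indicator {0..} t \<partial>lborel)"
    using l by (simp add: mult.assoc[symmetric] flip: ennreal_mult powr_add)
  finally show ?thesis using k by (simp add: ennreal_mult Gamma_real_nonneg)
qed

text \<open>With a remainder of second order, differentiation under the integral sign reduces to one
  pointwise estimate that is then integrated.\<close>

lemma DERIV_quadratic_bound:
  fixes f :: "real \<Rightarrow> real"
  assumes e: "e > 0" and bound: "\<And>y. \<bar>y - x\<bar> < e \<Longrightarrow> \<bar>f y - f x - D * (y - x)\<bar> \<le> Q * (y - x)\<^sup>2"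
  shows "(f has_real_derivative D) (at x)"
  unfolding has_field_derivative_iff
proof (rule LIM_zero_cancel, rule tendsto_0_le[where K=1])
  show "((\<lambda>y. Q * (y - x)) \<longlongrightarrow> 0) (at x)"
    by (rule tendsto_eq_intros refl | simp)+
  have "eventually (\<lambda>y. y \<in> ball x e \<and> y \<noteq> x) (at x)"
    using e by (intro eventually_conj eventually_at_in_open') (auto simp: eventually_at_filter)
  then show "\<forall>\<^sub>F y in at x. norm ((f y - f x) / (y - x) - D) \<le> norm (Q * (y - x)) * 1"
  proof eventually_elim
    case (elim y)
    then have *: "\<bar>f y - f x - D * (y - x)\<bar> \<le> Q * (y - x)\<^sup>2"
      by (intro bound) (auto simp: dist_real_def)
    have "(f y - f x) / (y - x) - D = (f y - f x - D * (y - x)) / (y - x)"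
      using elim by (simp add: diff_divide_distrib)
    then have "\<bar>(f y - f x) / (y - x) - D\<bar> = \<bar>f y - f x - D * (y - x)\<bar> / \<bar>y - x\<bar>"
      by (simp only: abs_divide)
    also have "\<dots> \<le> Q * (y - x)\<^sup>2 / \<bar>y - x\<bar>"
      using * by (rule divide_right_mono) simp
    also have "\<dots> = Q * \<bar>y - x\<bar>"
    proof -
      have "(y - x)\<^sup>2 = \<bar>y - x\<bar> * \<bar>y - x\<bar>" by (simp add: power2_eq_square)
      then show ?thesis using elim by (simp del: abs_mult_self_eq)
    qed
    also have "\<dots> \<le> \<bar>Q * (y - x)\<bar>" by (simp add: abs_mult mult_right_mono)
    finally show ?case by simp
  qed
qed

text \<open>Factoring out exp (- b) leaves the remainder of exp at 0, estimated through
  \<open>1 + h \<le> exp h\<close> at h and at - h. This yields the constant 1 in place of Taylor's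
  1 / 2. The minimum in the exponent allows a common integrable majorant.\<close>

lemma exp_second_order:
  fixes a b :: real
  shows "\<bar>exp (- a) - exp (- b) + (a - b) * exp (- b)\<bar> \<le> (a - b)\<^sup>2 * exp (- min a b)"
proof -
  define h where "h = b - a"
  have e: "exp (- a) = exp (- b) * exp h" unfolding h_def by (simp add: exp_add[symmetric])
  have lo: "1 + h \<le> exp h" by simp
  have "(1 - h) \<le> exp (- h)" using exp_ge_add_one_self[of "- h"] by simp
  then have "(1 - h) * exp h \<le> exp (- h) * exp h" by (rule mult_right_mono) simp
  then have up: "exp h - 1 \<le> h * exp h" by (simp add: exp_minus algebra_simps)
  then have "exp h - 1 - h \<le> h * (exp h - 1)" by (simp add: algebra_simps)
  also have "\<dots> \<le> h\<^sup>2 * max 1 (exp h)"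
  proof (cases "h \<ge> 0")
    case True
    have "h * (exp h - 1) \<le> h * (h * exp h)" using up True by (rule mult_left_mono)
    also have "\<dots> \<le> h\<^sup>2 * max 1 (exp h)"
      by (simp add: power2_eq_square mult.assoc mult_left_mono flip: mult.assoc)
    finally show ?thesis .
  next
    case False
    have "1 - exp h \<le> - h" using lo by linarith
    then have "(- h) * (1 - exp h) \<le> (- h) * (- h)" using False by (intro mult_left_mono) auto
    also have "\<dots> \<le> h\<^sup>2 * max 1 (exp h)"
      using mult_left_mono[of 1 "max 1 (exp h)" "h\<^sup>2"] by (simp add: power2_eq_square)
    finally show ?thesis by (simp add: algebra_simps)
  qed
  finally have "\<bar>exp h - 1 - h\<bar> \<le> h\<^sup>2 * max 1 (exp h)" using lo by linarith
  then have "exp (- b) * \<bar>exp h - 1 - h\<bar> \<le> exp (- b) * (h\<^sup>2 * max 1 (exp h))"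
    by (intro mult_left_mono) auto
  also have "\<dots> = h\<^sup>2 * max (exp (- b)) (exp (- a))"
    unfolding e by (auto simp: max_def mult_ac)
  also have "max (exp (- b)) (exp (- a)) = exp (- min a b)"
    by (simp add: max_def min_def)
  also have "exp (- b) * \<bar>exp h - 1 - h\<bar> = \<bar>exp (- b) * (exp h - 1 - h)\<bar>"
    by (simp add: abs_mult)
  also have "exp (- b) * (exp h - 1 - h) = exp (- a) - exp (- b) + (a - b) * exp (- b)"
    unfolding e by (simp add: h_def algebra_simps)
  finally show ?thesis unfolding h_def by (simp add: power2_commute)
qed

text \<open>The bound \<open>growth\<close> makes the weighted integrals finite; it will come from
  the Bishop-Gromov monotonicity, with B the volume of the Euclidean unit ball.\<close>

locale radial_space = proper_mm_space m for m :: "'a::polish_space measure" +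
  fixes x0 :: 'a and q N B :: real
  assumes q: "q > 1" and N0: "N > 0"
    and growth: "\<And>r. r > 0 \<Longrightarrow> measure m (ball x0 r) \<le> B * r powr N"
begin

definition D :: "'a \<Rightarrow> real" where "D x = dist x0 x powr q"
definition F :: "real \<Rightarrow> real" where "F l = (LINT x|m. exp (- l * D x))"
text \<open>Minus the derivative of \<open>F\<close>. Up to factors it is also the bound for the
  gradient integral and the limit of the entropy integrals of the test functions.\<close>

definition H :: "real \<Rightarrow> real" where "H l = (LINT x|m. D x * exp (- l * D x))"

lemma Nq: "N / q > 0" "N / q > -1" "N / q + 1 > -1"
proof -
  show "N / q > 0" using q N0 by simp
  then show "N / q > -1" "N / q + 1 > -1" by linarith+
qed

lemma Gamma_pos: "Gamma (N / q + 1) > 0" "Gamma (N / q + 2) > 0"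
  using Nq(1) by (intro Gamma_real_pos; linarith)+

lemma D_nonneg [simp]: "D x \<ge> 0" by (simp add: D_def)

lemma D_measurable [measurable]: "D \<in> borel_measurable m"
  unfolding D_def by measurable

lemma D_less_iff: "s \<ge> 0 \<Longrightarrow> D x < s \<longleftrightarrow> x \<in> ball x0 (s powr (1 / q))"
proof -
  assume s: "s \<ge> 0"
  have "D x < s \<longleftrightarrow> D x powr (1 / q) < s powr (1 / q)"
    using q s powr_less_mono2[of "1 / q" "D x" s] powr_mono2[of "1 / q" s "D x"]
    by (cases "D x < s") auto
  also have "D x powr (1 / q) = dist x0 x" using q by (simp add: D_def powr_powr)
  finally show ?thesis by simp
qed

lemma measure_ball_measurable [measurable]: "(\<lambda>r. measure m (ball x0 r)) \<in> borel_measurable borel"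
  by (rule borel_measurable_mono, intro monoI measure_mono_bounded subset_ball) auto

text \<open>Fubini, after the exponential has been written as an integral over s > D x; this is how
  bounds on ball volumes pass to \<open>F\<close>.\<close>

lemma layer_cake:
  assumes l: "l > 0"
  shows "(\<integral>\<^sup>+ x. ennreal (exp (- l * D x)) \<partial>m) =
    (\<integral>\<^sup>+ s. ennreal (measure m (ball x0 (s powr (1 / q))) * (l * exp (- l * s))) * indicator {0..} s \<partial>lborel)"
proof -
  interpret sigma_finite_measure m by (rule sigma_finite_m)
  interpret P: pair_sigma_finite m lborel ..
  have "(\<integral>\<^sup>+ x. ennreal (exp (- l * D x)) \<partial>m) =
      (\<integral>\<^sup>+ x. (\<integral>\<^sup>+ s. ennreal (l * exp (- l * s)) * indicator {D x<..} s \<partial>lborel) \<partial>m)"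
    by (simp only: nn_integral_exponential_tail[OF l])
  also have "\<dots> = (\<integral>\<^sup>+ x. (\<integral>\<^sup>+ s. ennreal (l * exp (- l * s)) * (if D x < s then 1 else 0) \<partial>lborel) \<partial>m)"
    by (intro nn_integral_cong) (auto simp: indicator_def)
  also have "\<dots> = (\<integral>\<^sup>+ s. (\<integral>\<^sup>+ x. ennreal (l * exp (- l * s)) * (if D x < s then 1 else 0) \<partial>m) \<partial>lborel)"
    by (rule P.Fubini'[symmetric]) measurable
  also have "\<dots> = (\<integral>\<^sup>+ s. ennreal (measure m (ball x0 (s powr (1 / q))) * (l * exp (- l * s))) * indicator {0..} s \<partial>lborel)"
  proof (rule nn_integral_cong)
    fix s :: real
    show "(\<integral>\<^sup>+ x. ennreal (l * exp (- l * s)) * (if D x < s then 1 else 0) \<partial>m) =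
        ennreal (measure m (ball x0 (s powr (1 / q))) * (l * exp (- l * s))) * indicator {0..} s"
    proof (cases "s \<ge> 0")
      case True
      have "(\<integral>\<^sup>+ x. ennreal (l * exp (- l * s)) * (if D x < s then 1 else 0) \<partial>m) =
          (\<integral>\<^sup>+ x. ennreal (l * exp (- l * s)) * indicator (ball x0 (s powr (1 / q))) x \<partial>m)"
        by (intro nn_integral_cong) (simp add: D_less_iff[OF True] indicator_def)
      also have "\<dots> = ennreal (l * exp (- l * s)) * emeasure m (ball x0 (s powr (1 / q)))"
        by (rule nn_integral_cmult_indicator) (simp add: sets_m)
      also have "\<dots> = ennreal (measure m (ball x0 (s powr (1 / q))) * (l * exp (- l * s)))"
        using l by (simp add: emeasure_bounded mult.commute flip: ennreal_mult)
      finally show ?thesis using True by simp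
    next
      case False
      have "\<not> D x < s" for x using False D_nonneg[of x] by linarith
      then show ?thesis using False by simp
    qed
  qed
  finally show ?thesis .
qed

text \<open>The constant A covers the radii at which a pure power bound fails. The exponential law
  has mass 1, so A enters unchanged and is negligible against \<open>l powr (- (N / q))\<close> as l
  tends to 0.\<close>

lemma nn_integral_exp_upper:
  assumes l: "l > 0" and A: "A \<ge> 0" and b: "b \<ge> 0"
    and le: "\<And>r. r > 0 \<Longrightarrow> measure m (ball x0 r) \<le> A + b * r powr N"
  shows "(\<integral>\<^sup>+ x. ennreal (exp (- l * D x)) \<partial>m) \<le> ennreal (A + b * (l powr (- (N / q)) * Gamma (N / q + 1)))"
proof -
  have "(\<integral>\<^sup>+ x. ennreal (exp (- l * D x)) \<partial>m) \<le>
    (\<integral>\<^sup>+ s. ennreal A * (ennreal (l * exp (- l * s)) * indicator {0<..} s) +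
      ennreal b * (ennreal (s powr (N / q) * (l * exp (- l * s))) * indicator {0..} s) \<partial>lborel)"
    unfolding layer_cake[OF l]
  proof (rule nn_integral_mono)
    fix s :: real
    show "ennreal (measure m (ball x0 (s powr (1 / q))) * (l * exp (- l * s))) * indicator {0..} s \<le>
      ennreal A * (ennreal (l * exp (- l * s)) * indicator {0<..} s) +
      ennreal b * (ennreal (s powr (N / q) * (l * exp (- l * s))) * indicator {0..} s)"
    proof (cases "s > 0")
      case True
      have "measure m (ball x0 (s powr (1 / q))) \<le> A + b * s powr (N / q)"
        using le[of "s powr (1 / q)"] True by (simp add: powr_powr)
      then have "measure m (ball x0 (s powr (1 / q))) * (l * exp (- l * s)) \<le>
          (A + b * s powr (N / q)) * (l * exp (- l * s))"
        using l by (intro mult_right_mono) auto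
      also have "\<dots> = A * (l * exp (- l * s)) + b * (s powr (N / q) * (l * exp (- l * s)))"
        by (simp add: algebra_simps)
      finally show ?thesis
        using True l A b by (simp flip: ennreal_mult ennreal_plus)
    qed (auto simp: indicator_def)
  qed
  also have "\<dots> = ennreal A * ennreal (exp (- l * 0)) + ennreal b * ennreal (l powr (- (N / q)) * Gamma (N / q + 1))"
    by (subst nn_integral_add, simp, simp, subst (1 2) nn_integral_cmult, simp, simp)
      (simp only: nn_integral_exponential_tail[OF l] nn_integral_powr_exponential[OF l Nq(2)])
  also have "\<dots> = ennreal (A + b * (l powr (- (N / q)) * Gamma (N / q + 1)))"
    using A b Gamma_pos by (simp flip: ennreal_mult ennreal_plus)
  finally show ?thesis .
qed

text \<open>The correction repairs a lower bound known only for small radii. Its power N + q becomes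
  N / q + 1 in the variable s = r^q, so the loss is of lower order as l tends to infinity.\<close>

lemma nn_integral_exp_lower:
  assumes l: "l > 0" and b: "b \<ge> 0" and c: "c \<ge> 0"
    and le: "\<And>r. r > 0 \<Longrightarrow> c * r powr N \<le> measure m (ball x0 r) + b * r powr (N + q)"
  shows "ennreal (c * (l powr (- (N / q)) * Gamma (N / q + 1))) \<le> (\<integral>\<^sup>+ x. ennreal (exp (- l * D x)) \<partial>m)
     + ennreal (b * (l powr (- (N / q + 1)) * Gamma (N / q + 2)))"
proof -
  have "ennreal (c * (l powr (- (N / q)) * Gamma (N / q + 1))) =
     (\<integral>\<^sup>+ s. ennreal c * (ennreal (s powr (N / q) * (l * exp (- l * s))) * indicator {0..} s) \<partial>lborel)"
    using Gamma_pos c by (subst nn_integral_cmult, simp, subst nn_integral_powr_exponential[OF l Nq(2)])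
      (simp flip: ennreal_mult)
  also have "\<dots> \<le> (\<integral>\<^sup>+ s. ennreal (measure m (ball x0 (s powr (1 / q))) * (l * exp (- l * s))) * indicator {0..} s +
      ennreal b * (ennreal (s powr (N / q + 1) * (l * exp (- l * s))) * indicator {0..} s) \<partial>lborel)"
  proof (rule nn_integral_mono)
    fix s :: real
    show "ennreal c * (ennreal (s powr (N / q) * (l * exp (- l * s))) * indicator {0..} s) \<le>
      ennreal (measure m (ball x0 (s powr (1 / q))) * (l * exp (- l * s))) * indicator {0..} s +
      ennreal b * (ennreal (s powr (N / q + 1) * (l * exp (- l * s))) * indicator {0..} s)"
    proof (cases "s > 0")
      case True
      have "1 / q * (N + q) = N / q + 1" using q by (simp add: field_simps)
      then have "c * s powr (N / q) \<le> measure m (ball x0 (s powr (1 / q))) + b * s powr (N / q + 1)"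
        using le[of "s powr (1 / q)"] True by (simp add: powr_powr)
      then have "c * s powr (N / q) * (l * exp (- l * s)) \<le>
          (measure m (ball x0 (s powr (1 / q))) + b * s powr (N / q + 1)) * (l * exp (- l * s))"
        using l by (intro mult_right_mono) auto
      then have "c * (s powr (N / q) * (l * exp (- l * s))) \<le> measure m (ball x0 (s powr (1 / q))) * (l * exp (- l * s))
          + b * (s powr (N / q + 1) * (l * exp (- l * s)))"
        by (simp add: algebra_simps)
      then show ?thesis
        using True l b c by (simp flip: ennreal_mult ennreal_plus)
    qed (auto simp: indicator_def)
  qed
  also have "\<dots> = (\<integral>\<^sup>+ x. ennreal (exp (- l * D x)) \<partial>m) +
      ennreal b * ennreal (l powr (- (N / q + 1)) * Gamma (N / q + 1 + 1))"
    unfolding layer_cake[OF l]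
    by (subst nn_integral_add, simp, simp, subst nn_integral_cmult, simp)
      (simp only: nn_integral_powr_exponential[OF l Nq(3)])
  also have "ennreal b * ennreal (l powr (- (N / q + 1)) * Gamma (N / q + 1 + 1)) =
     ennreal (b * (l powr (- (N / q + 1)) * Gamma (N / q + 2)))"
    using b Gamma_pos by (simp add: add.assoc flip: ennreal_mult)
  finally show ?thesis .
qed

lemma B_nonneg: "B \<ge> 0"
  using growth[of 1] measure_nonneg[of m "ball x0 1"] by (simp del: measure_nonneg)

lemma integrable_exp [simp]: "l > 0 \<Longrightarrow> integrable m (\<lambda>x. exp (- l * D x))"
proof (rule integrableI_nonneg)
  assume l: "l > 0"
  have "(\<integral>\<^sup>+ x. ennreal (exp (- l * D x)) \<partial>m) \<le> ennreal (0 + B * (l powr (- (N / q)) * Gamma (N / q + 1)))"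
    using growth by (intro nn_integral_exp_upper l B_nonneg) auto
  then show "(\<integral>\<^sup>+ x. ennreal (exp (- l * D x)) \<partial>m) < \<infinity>" by (rule le_less_trans) simp
qed auto

lemma nn_integral_F: "l > 0 \<Longrightarrow> (\<integral>\<^sup>+ x. ennreal (exp (- l * D x)) \<partial>m) = ennreal (F l)"
  unfolding F_def by (intro nn_integral_eq_integral integrable_exp) auto

lemma F_nonneg: "F l \<ge> 0"
  unfolding F_def by (rule integral_nonneg_AE) auto

lemma F_upper:
  assumes "l > 0" "A \<ge> 0" "b \<ge> 0" "\<And>r. r > 0 \<Longrightarrow> measure m (ball x0 r) \<le> A + b * r powr N"
  shows "F l \<le> A + b * (l powr (- (N / q)) * Gamma (N / q + 1))"
proof -
  have "ennreal (F l) \<le> ennreal (A + b * (l powr (- (N / q)) * Gamma (N / q + 1)))"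
    unfolding nn_integral_F[OF assms(1), symmetric] by (rule nn_integral_exp_upper) (use assms in auto)
  moreover have "A + b * (l powr (- (N / q)) * Gamma (N / q + 1)) \<ge> 0"
    using assms(1-3) Gamma_pos by simp
  ultimately show ?thesis by (simp add: ennreal_le_iff)
qed

lemma F_lower:
  assumes "l > 0" "b \<ge> 0" "c \<ge> 0" "\<And>r. r > 0 \<Longrightarrow> c * r powr N \<le> measure m (ball x0 r) + b * r powr (N + q)"
  shows "c * (l powr (- (N / q)) * Gamma (N / q + 1)) \<le> F l + b * (l powr (- (N / q + 1)) * Gamma (N / q + 2))"
proof -
  have "b * (l powr (- (N / q + 1)) * Gamma (N / q + 2)) \<ge> 0"
    using assms(1-3) Gamma_pos by simp
  moreover have "ennreal (c * (l powr (- (N / q)) * Gamma (N / q + 1))) \<le> ennreal (F l)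
     + ennreal (b * (l powr (- (N / q + 1)) * Gamma (N / q + 2)))"
    unfolding nn_integral_F[OF assms(1), symmetric] by (rule nn_integral_exp_lower) (use assms in auto)
  ultimately show ?thesis
    using F_nonneg[of l] by (simp flip: ennreal_plus)
qed

text \<open>A factor \<open>D x\<close> is absorbed by half of the exponential rate; used twice,
  this makes the second moment integrable.\<close>

lemma D_exp_le: "l > 0 \<Longrightarrow> D x * exp (- l * D x) \<le> 2 / l * exp (- (l / 2) * D x)"
proof -
  assume l: "l > 0"
  have "l / 2 * D x \<le> exp (l / 2 * D x)" using exp_ge_add_one_self[of "l / 2 * D x"] by linarith
  then have "D x \<le> 2 / l * exp (l / 2 * D x)" using l by (simp add: field_simps)
  then have "D x * exp (- l * D x) \<le> 2 / l * exp (l / 2 * D x) * exp (- l * D x)"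
    by (rule mult_right_mono) simp
  also have "\<dots> = 2 / l * exp (- (l / 2) * D x)"
    by (simp add: mult.assoc exp_add[symmetric])
  finally show ?thesis .
qed

lemma integrable_D_exp [simp]: "l > 0 \<Longrightarrow> integrable m (\<lambda>x. D x * exp (- l * D x))"
proof (rule Bochner_Integration.integrable_bound)
  assume l: "l > 0"
  show "integrable m (\<lambda>x. 2 / l * exp (- (l / 2) * D x))"
    using l by (intro integrable_mult_right integrable_exp) auto
  show "AE x in m. norm (D x * exp (- l * D x)) \<le> norm (2 / l * exp (- (l / 2) * D x))"
    using D_exp_le[OF l] l by (auto simp: abs_mult)
qed auto

lemma integrable_D2_exp: "l > 0 \<Longrightarrow> integrable m (\<lambda>x. (D x)\<^sup>2 * exp (- l * D x))"
proof (rule Bochner_Integration.integrable_bound)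
  assume l: "l > 0"
  show "integrable m (\<lambda>x. 2 / l * (D x * exp (- (l / 2) * D x)))"
    using l by (intro integrable_mult_right integrable_D_exp) auto
  show "AE x in m. norm ((D x)\<^sup>2 * exp (- l * D x)) \<le> norm (2 / l * (D x * exp (- (l / 2) * D x)))"
  proof (rule AE_I2)
    fix x
    have "D x * (D x * exp (- l * D x)) \<le> D x * (2 / l * exp (- (l / 2) * D x))"
      using D_exp_le[OF l] by (intro mult_left_mono) auto
    then show "norm ((D x)\<^sup>2 * exp (- l * D x)) \<le> norm (2 / l * (D x * exp (- (l / 2) * D x)))"
      using l by (simp add: abs_mult power2_eq_square mult_ac)
  qed
qed auto

lemma F_has_derivative:
  assumes l: "l > 0"
  shows "(F has_real_derivative - H l) (at l)"
proof (rule DERIV_quadratic_bound)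
  show "l / 2 > 0" using l by simp
  \<comment> \<open>Within l / 2 of l both rates exceed l / 2, so one integrable majorant serves all
    such k.\<close>
  fix k assume k: "\<bar>k - l\<bar> < l / 2"
  then have k0: "k > l / 2" by linarith
  have i: "integrable m (\<lambda>x. (k - l)\<^sup>2 * ((D x)\<^sup>2 * exp (- (l / 2) * D x)))"
    using l by (intro integrable_mult_right integrable_D2_exp) auto
  have eq: "F k - F l - (- H l) * (k - l) =
      (LINT x|m. exp (- k * D x) - exp (- l * D x) + (k - l) * (D x * exp (- l * D x)))"
    unfolding F_def H_def using integrable_exp[of k] integrable_exp[OF l] integrable_D_exp[OF l] k0 l by simp
  have "\<bar>F k - F l - (- H l) * (k - l)\<bar> \<le> (LINT x|m. (k - l)\<^sup>2 * ((D x)\<^sup>2 * exp (- (l / 2) * D x)))"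
    unfolding eq
  proof (rule order_trans[OF integral_abs_bound], rule integral_mono'[OF i])
    fix x
    have "\<bar>exp (- (k * D x)) - exp (- (l * D x)) + (k * D x - l * D x) * exp (- (l * D x))\<bar> \<le>
        (k * D x - l * D x)\<^sup>2 * exp (- min (k * D x) (l * D x))"
      by (rule exp_second_order)
    also have "\<dots> \<le> (k * D x - l * D x)\<^sup>2 * exp (- (l / 2 * D x))"
    proof -
      have "l / 2 * D x \<le> k * D x" "l / 2 * D x \<le> l * D x" using k0 l by (intro mult_right_mono; simp)+
      then show ?thesis by (intro mult_left_mono) auto
    qed
    also have "\<dots> = (k - l)\<^sup>2 * ((D x)\<^sup>2 * exp (- (l / 2) * D x))"
      by (simp add: left_diff_distrib[symmetric] power_mult_distrib)
    also have "(k * D x - l * D x) * exp (- (l * D x)) = (k - l) * (D x * exp (- l * D x))"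
      by (simp add: algebra_simps)
    finally show "\<bar>exp (- k * D x) - exp (- l * D x) + (k - l) * (D x * exp (- l * D x))\<bar> \<le>
       (k - l)\<^sup>2 * ((D x)\<^sup>2 * exp (- (l / 2) * D x))" by simp
  qed auto
  also have "\<dots> = (LINT x|m. (D x)\<^sup>2 * exp (- (l / 2) * D x)) * (k - l)\<^sup>2"
    by (subst integral_mult_right_zero) (rule mult.commute)
  finally show "\<bar>F k - F l - (- H l) * (k - l)\<bar> \<le> (LINT x|m. (D x)\<^sup>2 * exp (- (l / 2) * D x)) * (k - l)\<^sup>2" .
qed

lemma F_pos:
  assumes l: "l > 0"
  shows "F l > 0"
proof -
  have "0 < exp (- l * 1) * measure m (ball x0 1)" using measure_ball_pos[of 1 x0] by simp
  also have "\<dots> = (LINT x|m. exp (- l * 1) * indicator (ball x0 1) x)" by simp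
  also have "\<dots> \<le> F l"
    unfolding F_def
  proof (rule integral_mono'[OF integrable_exp[OF l]])
    fix x
    show "exp (- l * 1) * indicat_real (ball x0 1) x \<le> exp (- l * D x)"
    proof (cases "x \<in> ball x0 1")
      case True
      then have "D x < 1" using D_less_iff[of 1 x] by simp
      then show ?thesis using True l by simp
    qed simp
  qed auto
  finally show ?thesis .
qed

end


section \<open>The logarithmic Sobolev inequality for radial functions\<close>

text \<open>The Lipschitz factor may depend on y, because the estimates for the profile involve both
  endpoints and become the exact derivative only as y tends to x.\<close>

lemma local_slope_le:
  assumes ev: "eventually (\<lambda>y. \<bar>u y - u x\<bar> \<le> k y * dist x y) (at x)"
    and lim: "(k \<longlongrightarrow> \<kappa>) (at x)" and \<kappa>: "\<kappa> \<ge> 0"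
  shows "local_slope u x \<le> \<kappa>"
proof (rule field_le_epsilon)
  fix e :: real assume e: "e > 0"
  have "Limsup (at x) (\<lambda>y. ennreal (\<bar>u y - u x\<bar> / dist x y)) \<le> ennreal (\<kappa> + e)"
  proof (rule Limsup_bounded)
    have "eventually (\<lambda>y. k y < \<kappa> + e) (at x)"
      using order_tendstoD(2)[OF lim, of "\<kappa> + e"] e by simp
    moreover have "eventually (\<lambda>y. y \<noteq> x) (at x)" by (simp add: eventually_at_filter)
    ultimately show "\<forall>\<^sub>F y in at x. ennreal (\<bar>u y - u x\<bar> / dist x y) \<le> ennreal (\<kappa> + e)"
      using ev
    proof eventually_elim
      case (elim y)
      then have "dist x y > 0" by simp
      moreover have "\<bar>u y - u x\<bar> \<le> (\<kappa> + e) * dist x y"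
      proof -
        have "k y * dist x y \<le> (\<kappa> + e) * dist x y" using elim by (intro mult_right_mono) auto
        then show ?thesis using elim by linarith
      qed
      ultimately show ?case by (intro ennreal_leI) (simp add: divide_le_eq)
    qed
  qed
  then have "local_slope u x \<le> enn2real (ennreal (\<kappa> + e))"
    unfolding local_slope_def by (intro enn2real_mono) auto
  then show "local_slope u x \<le> \<kappa> + e" using \<kappa> e by (simp del: ennreal_plus)
qed

text \<open>The power is largest at b and the exponential at a, so each is taken at its worst
  endpoint. The mean value theorem serves the power alone; the exponential is handled by 1 - exp (-
  h) \<le> h.\<close>

lemma exp_powr_diff_le:
  fixes a b c q :: real
  assumes a: "0 \<le> a" "a \<le> b" and c: "c \<ge> 0" and q: "q > 1"
  shows "\<bar>exp (- c * a powr q) - exp (- c * b powr q)\<bar> \<le> c * q * b powr (q - 1) * exp (- c * a powr q) * (b - a)"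
proof (cases "a = b")
  case False
  then have ab: "a < b" using a by simp
  have "\<exists>l z. a < z \<and> z < b \<and> DERIV (\<lambda>s. s powr q) z :> l \<and> b powr q - a powr q = (b - a) * l"
  proof (rule MVT[OF ab])
    show "continuous_on {a..b} (\<lambda>s. s powr q)"
      using a q by (intro continuous_on_powr') auto
    show "(\<lambda>s. s powr q) differentiable at x" if "a < x" for x
      using has_real_derivative_powr[of x q] that a real_differentiable_def by auto
  qed
  then obtain l z where z: "a < z" "z < b" and l: "DERIV (\<lambda>s. s powr q) z :> l"
    and eq: "b powr q - a powr q = (b - a) * l" by blast
  have "l = q * z powr (q - 1)"
    using z a by (intro DERIV_unique[OF l] has_real_derivative_powr) auto
  also have "\<dots> \<le> q * b powr (q - 1)"
    using z a q by (intro mult_left_mono powr_mono2) auto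
  finally have "(b - a) * l \<le> (b - a) * (q * b powr (q - 1))"
    using ab by (intro mult_left_mono) auto
  then have d: "b powr q - a powr q \<le> q * b powr (q - 1) * (b - a)"
    unfolding eq by (simp add: mult_ac)
  have mono: "a powr q \<le> b powr q" using a q by (intro powr_mono2) auto
  define h where "h = c * (b powr q - a powr q)"
  have "exp (- c * a powr q) - exp (- c * b powr q) = exp (- c * a powr q) * (1 - exp (- h))"
    unfolding h_def by (simp add: right_diff_distrib exp_add[symmetric] algebra_simps)
  also have "\<dots> \<le> exp (- c * a powr q) * h"
    using exp_ge_add_one_self[of "- h"] by (intro mult_left_mono) auto
  also have "\<dots> \<le> exp (- c * a powr q) * (c * (q * b powr (q - 1) * (b - a)))"
    unfolding h_def using c d by (intro mult_left_mono) auto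
  finally have "exp (- c * a powr q) - exp (- c * b powr q) \<le> c * q * b powr (q - 1) * exp (- c * a powr q) * (b - a)"
    by (simp add: mult_ac)
  moreover have "c * a powr q \<le> c * b powr q" using mono c by (rule mult_left_mono)
  ultimately show ?thesis by simp
qed simp

lemma exp_powr_diff_le':
  fixes a b c q :: real
  assumes "0 \<le> a" "0 \<le> b" "c \<ge> 0" "q > 1"
  shows "\<bar>exp (- c * a powr q) - exp (- c * b powr q)\<bar> \<le>
    c * q * (max a b) powr (q - 1) * exp (- c * (min a b) powr q) * \<bar>b - a\<bar>"
  using exp_powr_diff_le[of a b c q] exp_powr_diff_le[of b a c q] assms
  by (cases "a \<le> b") (auto simp: max_def min_def abs_minus_commute)

text \<open>From ln s \<le> s - 1 at s = 1 / sqrt y. A square root only halves the rate of an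
  exponential, which gives an integrable majorant for the entropy integrals.\<close>

lemma abs_x_ln_x_le:
  fixes y :: real
  assumes "0 \<le> y" "y \<le> 1"
  shows "\<bar>y * ln y\<bar> \<le> 2 * sqrt y"
proof (cases "y = 0")
  case False
  then have y: "y > 0" using assms by simp
  have "ln (1 / sqrt y) \<le> 1 / sqrt y - 1" using y by (intro ln_le_minus_one) auto
  moreover have "ln (1 / sqrt y) = - ln y / 2" using y by (simp add: ln_div ln_sqrt)
  ultimately have "- ln y \<le> 2 / sqrt y" by simp
  then have "y * (- ln y) \<le> y * (2 / sqrt y)" using y by (intro mult_left_mono) auto
  also have "y * (2 / sqrt y) = 2 * (y / sqrt y)" by simp
  also have "y / sqrt y = sqrt y" using y by (intro real_div_sqrt) simp
  finally show ?thesis using y assms(2) by (simp add: abs_mult)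
qed simp

section \<open>Truncated extremals\<close>

locale log_sobolev_space = radial_space m x0 q "real n" B
  for m :: "'a::polish_space measure" and x0 :: 'a and q :: real and n :: nat and B :: real +
  fixes p C :: real
  assumes p: "p > 1" and q_def: "q = p / (p - 1)" and C: "C > 0"
    and lso: "log_sobolev m n p C"
begin

text \<open>The extremal is lowered by its value at radius R and cut off at 0, instead of being
  multiplied by a cutoff: in this way its slope never exceeds the slope bound of the full
  profile.\<close>

definition w :: "real \<Rightarrow> real \<Rightarrow> 'a \<Rightarrow> real" where
  "w l R x = max (exp (- (l / p) * D x) - exp (- (l / p) * R powr q)) 0"

lemma w_nonneg [simp]: "w l R x \<ge> 0" by (simp add: w_def)

lemma w_measurable [measurable]: "w l R \<in> borel_measurable m"
  unfolding w_def by measurable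

lemma w_powr_le: "w l R x powr p \<le> exp (- l * D x)"
proof -
  have "w l R x powr p \<le> exp (- (l / p) * D x) powr p"
    using p by (intro powr_mono2) (auto simp: w_def)
  also have "\<dots> = exp (- l * D x)" using p by (simp add: exp_powr_real)
  finally show ?thesis .
qed

lemma w_eq_0:
  assumes "l > 0" "R \<ge> 0" "x \<notin> cball x0 R"
  shows "w l R x = 0"
proof -
  have "R powr q \<le> D x" using assms q by (auto simp: D_def intro!: powr_mono2)
  then have "l / p * R powr q \<le> l / p * D x" using assms p by (intro mult_left_mono) auto
  then show ?thesis by (simp add: w_def)
qed

text \<open>With the distance frozen at R the factor r^(q - 1) stays below R^(q - 1), which yields a
  global Lipschitz constant.\<close>

lemma w_min:
  assumes "l > 0" "R \<ge> 0"
  shows "w l R x = exp (- (l / p) * (min (dist x0 x) R) powr q) - exp (- (l / p) * R powr q)"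
proof (cases "dist x0 x \<le> R")
  case True
  then have "dist x0 x powr q \<le> R powr q" using assms q by (intro powr_mono2) auto
  then have "l / p * D x \<le> l / p * R powr q"
    unfolding D_def using assms p by (intro mult_left_mono) auto
  then show ?thesis using True by (simp add: w_def D_def)
next
  case False
  then show ?thesis using w_eq_0[OF assms, of x] by (simp add: min_def)
qed

lemma abs_dist_diff: "\<bar>dist x0 y - dist x0 x\<bar> \<le> dist x y"
  using dist_triangle[of x0 y x] dist_triangle[of x0 x y] by (simp add: dist_commute abs_le_iff)

lemma w_Lip0:
  assumes l: "l > 0" and R: "R > 0" and a: "a \<ge> 0"
  shows "(\<lambda>x. a * w l R x) \<in> Lip0"
proof -
  define L where "L = l / p * q * R powr (q - 1)"
  have L: "L \<ge> 0" unfolding L_def using l p q by simp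
  have "(a * L)-lipschitz_on UNIV (\<lambda>x. a * w l R x)"
  proof (rule lipschitz_onI)
    fix x y
    let ?a = "min (dist x0 x) R" and ?b = "min (dist x0 y) R"
    have "\<bar>w l R x - w l R y\<bar> = \<bar>exp (- (l / p) * ?a powr q) - exp (- (l / p) * ?b powr q)\<bar>"
      using l R by (simp add: w_min)
    also have "\<dots> \<le> l / p * q * (max ?a ?b) powr (q - 1) * exp (- (l / p) * (min ?a ?b) powr q) * \<bar>?b - ?a\<bar>"
      using l p q R by (intro exp_powr_diff_le') auto
    also have "\<dots> \<le> l / p * q * R powr (q - 1) * 1 * dist x y"
    proof (intro mult_mono)
      show "\<bar>?b - ?a\<bar> \<le> dist x y" using abs_dist_diff[of y x] by linarith
      show "(max ?a ?b) powr (q - 1) \<le> R powr (q - 1)"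
        using q R by (intro powr_mono2) (auto simp: le_max_iff_disj)
    qed (use l p q R in auto)
    finally have "\<bar>w l R x - w l R y\<bar> \<le> L * dist x y" unfolding L_def by simp
    then have "a * \<bar>w l R x - w l R y\<bar> \<le> a * (L * dist x y)" using a by (rule mult_left_mono)
    then show "dist (a * w l R x) (a * w l R y) \<le> a * L * dist x y"
      using a by (simp add: dist_real_def right_diff_distrib[symmetric] abs_mult)
  qed (use a L in simp)
  moreover have "compact (closure {x. a * w l R x \<noteq> 0})"
  proof -
    have "{x. a * w l R x \<noteq> 0} \<subseteq> cball x0 R" using w_eq_0[OF l, of R] R by force
    then have "bounded {x. a * w l R x \<noteq> 0}" by (rule bounded_subset[rotated]) simp
    then show ?thesis using proper unfolding proper_space_def by (simp add: bounded_closure)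
  qed
  ultimately show ?thesis unfolding Lip0_def by blast
qed

text \<open>The positive part and the distance function are 1-Lipschitz, so the derivative of the
  untruncated profile is an upper bound at every point.\<close>

lemma slope_w_le:
  assumes l: "l > 0" and a: "a \<ge> 0"
  shows "local_slope (\<lambda>x. a * w l R x) x \<le> a * (l * q / p * dist x0 x powr (q - 1) * exp (- (l / p) * D x))"
proof (rule local_slope_le)
  let ?k = "\<lambda>y. a * (l * q / p * (max (dist x0 x) (dist x0 y)) powr (q - 1) *
     exp (- (l / p) * (min (dist x0 x) (dist x0 y)) powr q))"
  show "\<forall>\<^sub>F y in at x. \<bar>a * w l R y - a * w l R x\<bar> \<le> ?k y * dist x y"
  proof (rule always_eventually, rule allI)
    fix y
    have "\<bar>w l R y - w l R x\<bar> \<le> \<bar>exp (- (l / p) * dist x0 x powr q) - exp (- (l / p) * dist x0 y powr q)\<bar>"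
      unfolding w_def D_def by linarith
    also have "\<dots> \<le> l / p * q * (max (dist x0 x) (dist x0 y)) powr (q - 1) *
        exp (- (l / p) * (min (dist x0 x) (dist x0 y)) powr q) * \<bar>dist x0 y - dist x0 x\<bar>"
      using l p q by (intro exp_powr_diff_le') auto
    also have "\<dots> \<le> l / p * q * (max (dist x0 x) (dist x0 y)) powr (q - 1) *
        exp (- (l / p) * (min (dist x0 x) (dist x0 y)) powr q) * dist x y"
      using l p q abs_dist_diff[of y x] by (intro mult_left_mono) auto
    finally have "a * \<bar>w l R y - w l R x\<bar> \<le> a * (l / p * q * (max (dist x0 x) (dist x0 y)) powr (q - 1) *
        exp (- (l / p) * (min (dist x0 x) (dist x0 y)) powr q) * dist x y)"
      using a by (rule mult_left_mono)
    then show "\<bar>a * w l R y - a * w l R x\<bar> \<le> ?k y * dist x y"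
      using a by (simp add: right_diff_distrib[symmetric] abs_mult mult_ac)
  qed
  have "(?k \<longlongrightarrow> a * (l * q / p * (max (dist x0 x) (dist x0 x)) powr (q - 1) *
     exp (- (l / p) * (min (dist x0 x) (dist x0 x)) powr q))) (at x)"
    using q by (intro tendsto_intros tendsto_max tendsto_min tendsto_powr' tendsto_ident_at) auto
  then show "(?k \<longlongrightarrow> a * (l * q / p * dist x0 x powr (q - 1) * exp (- (l / p) * D x))) (at x)"
    by (simp add: D_def)
qed (use a l p q in simp)

lemma integrable_w: "l > 0 \<Longrightarrow> integrable m (\<lambda>x. w l R x powr p)"
  using w_powr_le[of l R] by (intro Bochner_Integration.integrable_bound[OF integrable_exp[of l]]) auto

lemma w_ln_bound: "l > 0 \<Longrightarrow> \<bar>w l R x powr p * ln (w l R x powr p)\<bar> \<le> 2 * exp (- (l / 2) * D x)"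
proof -
  assume l: "l > 0"
  have le: "w l R x powr p \<le> exp (- l * D x)" by (rule w_powr_le)
  also have "\<dots> \<le> 1" using l by simp
  finally have "\<bar>w l R x powr p * ln (w l R x powr p)\<bar> \<le> 2 * sqrt (w l R x powr p)"
    by (intro abs_x_ln_x_le) auto
  also have "sqrt (w l R x powr p) \<le> sqrt (exp (- l * D x))" using le by simp
  also have "sqrt (exp (- l * D x)) = exp (- (l / 2) * D x)"
    by (rule real_sqrt_unique) (simp_all add: power2_eq_square exp_add[symmetric])
  finally show ?thesis by simp
qed

lemma integrable_w_ln: "l > 0 \<Longrightarrow> integrable m (\<lambda>x. w l R x powr p * ln (w l R x powr p))"
  using w_ln_bound[of l R]
  by (intro Bochner_Integration.integrable_bound[OF integrable_mult_right[OF integrable_exp[of "l / 2"], of 2]]) auto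

lemma integral_w_pos:
  assumes l: "l > 0" and R: "R > 0"
  shows "(LINT x|m. w l R x powr p) > 0"
proof -
  define e where "e = exp (- (l / p) * (R / 2) powr q) - exp (- (l / p) * R powr q)"
  have "(R / 2) powr q < R powr q" using R q by (intro powr_less_mono2) auto
  then have "l / p * (R / 2) powr q < l / p * R powr q" using l p by (intro mult_strict_left_mono) auto
  then have e: "e > 0" by (simp add: e_def)
  have "0 < e powr p * measure m (ball x0 (R / 2))"
    using measure_ball_pos[of "R / 2" x0] R e by simp
  also have "\<dots> = (LINT x|m. e powr p * indicator (ball x0 (R / 2)) x)" by simp
  also have "\<dots> \<le> (LINT x|m. w l R x powr p)"
  proof (rule integral_mono'[OF integrable_w[OF l]])
    fix x
    show "e powr p * indicat_real (ball x0 (R / 2)) x \<le> w l R x powr p"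
    proof (cases "x \<in> ball x0 (R / 2)")
      case True
      then have "D x \<le> (R / 2) powr q" unfolding D_def using q by (intro powr_mono2) auto
      then have "l / p * D x \<le> l / p * (R / 2) powr q" using l p by (intro mult_left_mono) auto
      then have "exp (- (l / p) * (R / 2) powr q) \<le> exp (- (l / p) * D x)" by simp
      then have "e \<le> w l R x" unfolding e_def w_def by linarith
      then show ?thesis using True e p by (simp add: powr_mono2)
    qed simp
  qed auto
  finally show ?thesis .
qed

text \<open>Normalizing by \<open>A powr (- 1 / p)\<close> produces the term - ln A. The gradient
  integral is estimated at once by that of the untruncated profile, so R survives only in A and
  T.\<close>

lemma log_sobolev_w:
  assumes l: "l > 0" and R: "R > 0"
  defines "A \<equiv> (LINT x|m. w l R x powr p)"
    and "T \<equiv> (LINT x|m. w l R x powr p * ln (w l R x powr p))"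
  shows "H l > 0" "T / A - ln A \<le> n / p * ln (C * ((l * q / p) powr p * H l / A))"
proof -
  have A: "A > 0" unfolding A_def by (rule integral_w_pos[OF l R])
  define a where "a = A powr (- 1 / p)"
  have a: "a > 0" unfolding a_def using A by simp
  have ap: "a powr p = 1 / A" unfolding a_def using A p by (simp only: powr_powr) (simp add: powr_minus_divide)
  define u where "u x = a * w l R x" for x
  have up: "\<bar>u x\<bar> powr p = w l R x powr p / A" for x
    unfolding u_def using a by (simp add: abs_mult powr_mult ap)
  have uL: "u \<in> Lip0" unfolding u_def using w_Lip0[OF l R, of a] a by simp
  have "(LINT x|m. \<bar>u x\<bar> powr p) = 1"
    unfolding up using A by (simp add: A_def)
  then have "Lp_norm m p u = 1" by (simp add: Lp_norm_def)
  then have ls: "ereal (LINT x|m. \<bar>u x\<bar> powr p * ln (\<bar>u x\<bar> powr p))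
          \<le> ereal (real n / p) * log0 (C * Lp_norm m p (local_slope u) powr p)"
    using lso uL unfolding log_sobolev_def by blast
  have lhs: "(LINT x|m. \<bar>u x\<bar> powr p * ln (\<bar>u x\<bar> powr p)) = T / A - ln A"
  proof -
    have "(LINT x|m. \<bar>u x\<bar> powr p * ln (\<bar>u x\<bar> powr p)) =
        (LINT x|m. w l R x powr p * ln (w l R x powr p) / A - ln A / A * (w l R x powr p))"
    proof (rule Bochner_Integration.integral_cong[OF refl])
      fix x
      show "\<bar>u x\<bar> powr p * ln (\<bar>u x\<bar> powr p) =
          w l R x powr p * ln (w l R x powr p) / A - ln A / A * (w l R x powr p)"
      proof (cases "w l R x = 0")
        case False
        then have "w l R x powr p > 0" by simp
        then show ?thesis unfolding up using A by (simp add: ln_div field_simps)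
      qed (simp add: up)
    qed
    also have "\<dots> = T / A - ln A / A * A"
      unfolding A_def T_def using integrable_w[OF l] integrable_w_ln[OF l] by simp
    finally show ?thesis using A by simp
  qed
  define S where "S = (LINT x|m. \<bar>local_slope u x\<bar> powr p)"
  have S0: "S \<ge> 0" unfolding S_def by (rule integral_nonneg_AE) simp
  have SL: "Lp_norm m p (local_slope u) powr p = S"
    unfolding Lp_norm_def S_def[symmetric] using S0 p by (simp add: powr_powr)
  have Sle: "S \<le> (l * q / p) powr p * H l / A"
  proof -
    have i: "integrable m (\<lambda>x. (l * q / p) powr p / A * (D x * exp (- l * D x)))"
      by (intro integrable_mult_right integrable_D_exp l)
    \<comment> \<open>Only the majorant has to be integrable: a non-integrable function has Bochner
      integral 0, and S = 0 is excluded below.\<close>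
    have "S \<le> (LINT x|m. (l * q / p) powr p / A * (D x * exp (- l * D x)))"
      unfolding S_def
    proof (rule integral_mono'[OF i])
      fix x
      have "\<bar>local_slope u x\<bar> = local_slope u x" by (simp add: local_slope_def)
      also have "\<dots> \<le> a * (l * q / p * dist x0 x powr (q - 1) * exp (- (l / p) * D x))"
        unfolding u_def using slope_w_le[OF l, of a] a by simp
      finally have "\<bar>local_slope u x\<bar> powr p \<le> (a * (l * q / p * dist x0 x powr (q - 1) * exp (- (l / p) * D x))) powr p"
        using p by (intro powr_mono2) auto
      also have "\<dots> = a powr p * ((l * q / p) powr p * (dist x0 x powr (q - 1)) powr p * exp (- (l / p) * D x) powr p)"
        by (simp only: powr_mult)
      also have "(dist x0 x powr (q - 1)) powr p = D x"
      proof -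
        \<comment> \<open>The reason for this q: the p-th power of the slope carries exactly the
          weight \<open>D\<close> of \<open>H\<close>.\<close>
        have "(q - 1) * p = q" unfolding q_def using p by (simp add: field_simps)
        then show ?thesis by (simp add: powr_powr D_def)
      qed
      also have "exp (- (l / p) * D x) powr p = exp (- l * D x)" using p by (simp add: exp_powr_real)
      finally show "\<bar>local_slope u x\<bar> powr p \<le> (l * q / p) powr p / A * (D x * exp (- l * D x))"
        by (simp add: ap mult_ac)
    qed (use A in simp)
    also have "\<dots> = (l * q / p) powr p / A * H l" unfolding H_def by (rule integral_mult_right_zero)
    finally show ?thesis by simp
  qed
  \<comment> \<open>For S = 0 the right-hand side would be -\<infinity> by \<open>log0\<close>,
    below a real number. Positivity of \<open>H\<close> thus results from the inequality
    itself.\<close>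
  have S: "S > 0"
  proof (rule ccontr)
    assume "\<not> ?thesis"
    then have "S = 0" using S0 by simp
    moreover have "real n / p > 0" using N0 p by simp
    ultimately show False using ls N0 p unfolding SL lhs by (auto simp: log0_def split: if_splits)
  qed
  then have "(l * q / p) powr p * H l / A > 0" using Sle by simp
  moreover have "(l * q / p) powr p > 0" using l p q by simp
  ultimately show "H l > 0" using A by (simp add: zero_less_divide_iff zero_less_mult_iff)
  have "T / A - ln A \<le> n / p * ln (C * S)"
    using ls S C unfolding SL lhs by (simp add: log0_def)
  also have "\<dots> \<le> n / p * ln (C * ((l * q / p) powr p * H l / A))"
    using S C Sle N0 p by (intro mult_left_mono ln_mono) auto
  finally show "T / A - ln A \<le> n / p * ln (C * ((l * q / p) powr p * H l / A))" .
qed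

text \<open>The truncation radius tends to infinity. The integrands are dominated by exp (- l * D)
  and 2 * exp (- (l / 2) * D), and positivity of \<open>F\<close> and \<open>H\<close> keeps the
  logarithms continuous at the limit.\<close>

lemma log_sobolev_F:
  assumes l: "l > 0"
  shows "H l > 0" "- (l * H l / F l) - ln (F l) \<le> n / p * ln (C * ((l * q / p) powr p * H l / F l))"
proof -
  show H: "H l > 0" by (rule log_sobolev_w(1)[OF l zero_less_one])
  have F: "F l > 0" by (rule F_pos[OF l])
  let ?R = "\<lambda>k. real (Suc k)"
  have wlim: "(\<lambda>k. w l (?R k) x) \<longlonglongrightarrow> exp (- (l / p) * D x)" for x
  proof -
    have "(\<lambda>k. exp (- (l / p) * ?R k powr q)) \<longlonglongrightarrow> 0"
      using l p q by real_asymp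
    then have "(\<lambda>k. max (exp (- (l / p) * D x) - exp (- (l / p) * ?R k powr q)) 0) \<longlonglongrightarrow> max (exp (- (l / p) * D x) - 0) 0"
      by (intro tendsto_intros)
    then show ?thesis by (simp add: w_def)
  qed
  have wplim: "(\<lambda>k. w l (?R k) x powr p) \<longlonglongrightarrow> exp (- l * D x)" for x
  proof -
    have "(\<lambda>k. w l (?R k) x powr p) \<longlonglongrightarrow> exp (- (l / p) * D x) powr p"
      by (intro tendsto_powr wlim tendsto_const) simp
    then show ?thesis using p by (simp add: exp_powr_real)
  qed
  have A: "(\<lambda>k. LINT x|m. w l (?R k) x powr p) \<longlonglongrightarrow> F l"
    unfolding F_def
  proof (rule integral_dominated_convergence[OF _ _ integrable_exp[OF l]])
    show "AE x in m. (\<lambda>k. w l (?R k) x powr p) \<longlonglongrightarrow> exp (- l * D x)"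
      using wplim by simp
    show "AE x in m. norm (w l (?R k) x powr p) \<le> exp (- l * D x)" for k
      using w_powr_le by simp
  qed auto
  have T: "(\<lambda>k. LINT x|m. w l (?R k) x powr p * ln (w l (?R k) x powr p)) \<longlonglongrightarrow> (LINT x|m. exp (- l * D x) * ln (exp (- l * D x)))"
  proof (rule integral_dominated_convergence[OF _ _ integrable_mult_right[OF integrable_exp[of "l / 2"], of 2]])
    show "AE x in m. (\<lambda>k. w l (?R k) x powr p * ln (w l (?R k) x powr p)) \<longlonglongrightarrow> exp (- l * D x) * ln (exp (- l * D x))"
      by (intro AE_I2 tendsto_mult tendsto_ln wplim) simp
    show "AE x in m. norm (w l (?R k) x powr p * ln (w l (?R k) x powr p)) \<le> 2 * exp (- (l / 2) * D x)" for k
      using w_ln_bound[OF l] by simp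
  qed (use l in auto)
  have "(LINT x|m. exp (- l * D x) * ln (exp (- l * D x))) = (LINT x|m. (- l) * (D x * exp (- l * D x)))"
    by (simp add: mult_ac)
  also have "\<dots> = - l * H l" unfolding H_def by (rule integral_mult_right_zero)
  finally have T': "(\<lambda>k. LINT x|m. w l (?R k) x powr p * ln (w l (?R k) x powr p)) \<longlonglongrightarrow> - l * H l"
    using T by simp
  have "- l * H l / F l - ln (F l) \<le> n / p * ln (C * ((l * q / p) powr p * H l / F l))"
  proof (rule LIMSEQ_le)
    show "(\<lambda>k. (LINT x|m. w l (?R k) x powr p * ln (w l (?R k) x powr p)) / (LINT x|m. w l (?R k) x powr p)
        - ln (LINT x|m. w l (?R k) x powr p)) \<longlonglongrightarrow> - l * H l / F l - ln (F l)"
      using F by (intro tendsto_intros T' A) auto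
    have "C * ((l * q / p) powr p * H l / F l) > 0" using C l q p H F by simp
    then show "(\<lambda>k. n / p * ln (C * ((l * q / p) powr p * H l / (LINT x|m. w l (?R k) x powr p)))) \<longlonglongrightarrow>
        n / p * ln (C * ((l * q / p) powr p * H l / F l))"
      using F p by (intro tendsto_intros A) auto
    show "\<exists>N. \<forall>k\<ge>N. (LINT x|m. w l (?R k) x powr p * ln (w l (?R k) x powr p)) / (LINT x|m. w l (?R k) x powr p)
        - ln (LINT x|m. w l (?R k) x powr p) \<le>
        n / p * ln (C * ((l * q / p) powr p * H l / (LINT x|m. w l (?R k) x powr p)))"
      using log_sobolev_w(2)[OF l] by auto
  qed
  then show "- (l * H l / F l) - ln (F l) \<le> n / p * ln (C * ((l * q / p) powr p * H l / F l))"
    by simp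
qed

end


section \<open>Volume growth\<close>

lemma unit_ball_vol_pos': "unit_ball_vol (real n) > 0"
  by (rule unit_ball_vol_pos) simp

section \<open>The Euclidean constant\<close>

lemma log_sobolev_const_pos:
  assumes "p > 1" "n > 0"
  shows "log_sobolev_const p n > 0"
proof -
  have "unit_ball_vol (real n) * Gamma (real n / (p / (p - 1)) + 1) > 0"
    using assms by (intro mult_pos_pos unit_ball_vol_pos' Gamma_real_pos add_nonneg_pos) auto
  moreover have "p / real n > 0" "(p - 1) / exp 1 > 0" using assms by auto
  ultimately show ?thesis
    unfolding log_sobolev_const_def Let_def by (intro mult_pos_pos) (auto simp del: times_divide_eq_left)
qed

text \<open>In this shape the constant is compared in \<open>F_lower_critical\<close>, where
  everything is linear in logarithms. The exponent - p / n cancels the prefactor n / p, so the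
  volume and the Gamma value enter with coefficient - 1.\<close>

lemma ln_log_sobolev_const:
  assumes "p > 1" "n > 0"
  shows "real n / p * ln (log_sobolev_const p n) =
    real n / p * (ln p - ln (real n) + (p - 1) * (ln (p - 1) - 1))
      - ln (unit_ball_vol (real n)) - ln (Gamma (real n / (p / (p - 1)) + 1))"
proof -
  define G where "G = Gamma (real n / (p / (p - 1)) + 1)"
  have G: "G > 0"
    unfolding G_def using assms by (intro Gamma_real_pos add_nonneg_pos) auto
  have "ln (log_sobolev_const p n) = ln (p / real n) + (p - 1) * ln ((p - 1) / exp 1)
      + (- p / real n) * ln (unit_ball_vol (real n) * G)"
  proof -
    have *: "ln (a * b powr (p - 1) * y powr (- p / real n)) = ln a + (p - 1) * ln b + (- p / real n) * ln y"
      if "a > 0" "b > 0" "y > 0" for a b y :: real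
      using that by (simp add: ln_mult ln_powr)
    show ?thesis
      unfolding log_sobolev_const_def Let_def G_def[symmetric]
      by (rule * ) (use assms G unit_ball_vol_pos'[of n] in auto)
  qed
  also have "\<dots> = ln p - ln (real n) + (p - 1) * (ln (p - 1) - 1)
      - p / real n * (ln (unit_ball_vol (real n)) + ln G)"
    using assms G unit_ball_vol_pos'[of n, THEN less_imp_neq] by (simp add: ln_mult ln_div)
  finally show ?thesis
    unfolding G_def[symmetric] using assms by (simp add: right_diff_distrib distrib_left)
qed

section \<open>Lower bounds for the weighted volume\<close>

context log_sobolev_space
begin

lemma n_pos: "n > 0"
  using N0 by simp

text \<open>
  On \<open>\<real>\<^sup>n\<close> with \<open>C = log_sobolev_const p n\<close> the hypothesis and the conclusion hold with equality
  for every \<open>l\<close>.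
\<close>

lemma F_lower_critical:
  assumes l: "l > 0" and crit: "l * H l \<le> n / q * F l"
  shows "(log_sobolev_const p n / C) powr (n / p) * unit_ball_vol n * Gamma (n / q + 1) \<le> F l * l powr (n / q)"
proof -
  define L where "L = log_sobolev_const p n"
  define G where "G = Gamma (n / q + 1)"
  have F: "F l > 0" by (rule F_pos[OF l])
  have H: "H l > 0" by (rule log_sobolev_F(1)[OF l])
  have G: "G > 0" unfolding G_def by (rule Gamma_pos)
  have L: "L > 0" unfolding L_def by (rule log_sobolev_const_pos[OF p n_pos])
  have w: "unit_ball_vol (real n) > 0" by (rule unit_ball_vol_pos')
  have a: "n / q = n / p * (p - 1)" unfolding q_def using p by simp
  have lnq: "ln q = ln p - ln (p - 1)" unfolding q_def using p by (simp add: ln_div)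
  \<comment> \<open>This quotient enters \<open>log_sobolev_F\<close> both linearly and inside the
    logarithm. The resulting lower bound for ln (F l) decreases in it, so the largest admissible
    value n / q may be inserted.\<close>
  have g: "l * H l / F l \<le> n / q" using crit F by (simp add: divide_le_eq)
  have "H l / F l \<le> n / q / l"
    unfolding pos_le_divide_eq[OF l] using g by (simp add: mult.commute)
  then have "(l * q / p) powr p * (H l / F l) \<le> (l * q / p) powr p * (n / q / l)"
    by (rule mult_left_mono) simp
  then have "ln (C * ((l * q / p) powr p * H l / F l)) \<le> ln (C * ((l * q / p) powr p * (n / q / l)))"
    using C H F l q p by (intro ln_mono mult_left_mono) auto
  also have "\<dots> = ln C + p * (ln l + ln q - ln p) + (ln n - ln q - ln l)"
    using C l q p n_pos by (simp add: ln_mult ln_div ln_powr)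
  also have "\<dots> = ln C - (p - 1) * ln (p - 1) + (p - 1) * ln l + ln n - ln p"
    unfolding lnq by (simp add: algebra_simps)
  finally have "n / p * ln (C * ((l * q / p) powr p * H l / F l)) \<le>
      n / p * (ln C - (p - 1) * ln (p - 1) + (p - 1) * ln l + ln n - ln p)"
    using p by (intro mult_left_mono) auto
  with log_sobolev_F(2)[OF l] g have "ln (F l) \<ge> - (n / q)
      - n / p * (ln C - (p - 1) * ln (p - 1) + (p - 1) * ln l + ln n - ln p)"
    by linarith
  moreover have "n / p * (ln p - ln n + (p - 1) * (ln (p - 1) - 1) - ln C) = - (n / q)
      - n / p * (ln C - (p - 1) * ln (p - 1) + (p - 1) * ln l + ln n - ln p) + n / q * ln l"
  proof -
    \<comment> \<open>Here s = n / p, x = ln p, y = ln n, z = ln (p - 1), c = ln C and u = ln l; by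
      \<open>a\<close>, s * (p - 1) is n / q.\<close>
    have "s * (x - y + (p - 1) * (z - 1) - c) =
        - (s * (p - 1)) - s * (c - (p - 1) * z + (p - 1) * u + y - x) + s * (p - 1) * u" for s x y z c u
      by (simp add: algebra_simps)
    then show ?thesis unfolding a .
  qed
  ultimately have 1: "ln (F l) + n / q * ln l \<ge> n / p * (ln p - ln n + (p - 1) * (ln (p - 1) - 1) - ln C)"
    by linarith
  have "ln ((L / C) powr (n / p) * unit_ball_vol n * G) = n / p * ln L - n / p * ln C + ln (unit_ball_vol n) + ln G"
    using L C G w[THEN less_imp_neq] by (simp add: ln_mult ln_powr ln_div right_diff_distrib)
  also have "\<dots> = n / p * (ln p - ln n + (p - 1) * (ln (p - 1) - 1) - ln C)"
    unfolding L_def G_def q_def using ln_log_sobolev_const[OF p n_pos] by (simp add: right_diff_distrib)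
  also have "\<dots> \<le> ln (F l * l powr (n / q))"
    using 1 F l by (simp add: ln_mult ln_powr)
  finally show ?thesis
    unfolding L_def[symmetric] G_def[symmetric] using L C G w F l by (subst (asm) ln_le_cancel_iff) auto
qed

text \<open>
  A value below the bound would force \<open>F l * l powr (n / q)\<close> to have a minimum on \<open>[k, \<infinity>)\<close>,
  since the infinitesimal volume growth keeps it above the bound for large \<open>l\<close>; at the
  minimizer the right derivative is nonnegative, which is the hypothesis of
  \<open>F_lower_critical\<close>.
\<close>

lemma F_ge:
  assumes LC: "log_sobolev_const p n \<le> C"
    and low: "\<And>c. 0 \<le> c \<Longrightarrow> c < unit_ball_vol n \<Longrightarrow>
      \<exists>\<delta>>0. \<forall>r. 0 < r \<and> r < \<delta> \<longrightarrow> c * r powr n \<le> measure m (ball x0 r)"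
    and k: "k > 0"
  shows "(log_sobolev_const p n / C) powr (n / p) * unit_ball_vol n * Gamma (n / q + 1) \<le> F k * k powr (n / q)"
proof (rule ccontr)
  define E where "E l = F l * l powr (n / q)" for l
  define G where "G = Gamma (n / q + 1)"
  define G2 where "G2 = Gamma (n / q + 2)"
  define \<kappa> where "\<kappa> = (log_sobolev_const p n / C) powr (n / p) * unit_ball_vol n * G"
  assume "\<not> ?thesis"
  then have Ek: "E k < \<kappa>" unfolding E_def \<kappa>_def G_def by simp
  have G: "G > 0" "G2 > 0" unfolding G_def G2_def by (rule Gamma_pos)+
  have w: "unit_ball_vol (real n) > 0" by (rule unit_ball_vol_pos')
  have E0: "E k \<ge> 0" unfolding E_def using F_nonneg by simp
  \<comment> \<open>This is where \<open>LC\<close> enters: \<kappa> does not exceed the Euclidean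
    value, which leaves room for a c strictly between \<open>E k / G\<close> and the volume of the
    unit ball.\<close>
  have "(log_sobolev_const p n / C) powr (n / p) \<le> 1 powr (n / p)"
    using LC C p log_sobolev_const_pos[OF p n_pos] by (intro powr_mono2) auto
  then have "\<kappa> \<le> unit_ball_vol n * G" unfolding \<kappa>_def using w G by simp
  then have EG: "E k / G < unit_ball_vol n" using Ek G by (simp add: divide_less_eq)
  then obtain c where c3: "E k / G < c" and c2: "c < unit_ball_vol n"
    using dense by blast
  have "E k / G \<ge> 0" using E0 G by simp
  then have c: "c \<ge> 0" using c3 by linarith
  have cG: "E k < c * G" using c3 G by (simp add: divide_less_eq)
  obtain \<delta> where \<delta>: "\<delta> > 0" and lowd: "\<And>r. 0 < r \<Longrightarrow> r < \<delta> \<Longrightarrow> c * r powr n \<le> measure m (ball x0 r)"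
    using low[OF c c2] by blast
  \<comment> \<open>For r \<ge> \<delta> this makes \<open>b * r powr q\<close> at least c, so that
    the correction term dominates by itself.\<close>
  define b where "b = c * \<delta> powr (- q)"
  have b: "b \<ge> 0" unfolding b_def using c by simp
  have "c * r powr n \<le> measure m (ball x0 r) + b * r powr (n + q)" if r: "r > 0" for r
  proof (cases "r < \<delta>")
    case True
    then have "c * r powr n \<le> measure m (ball x0 r)" using lowd r by blast
    moreover have "0 \<le> b * r powr (n + q)" using b by simp
    ultimately show ?thesis by linarith
  next
    case False
    have "1 = \<delta> powr (- q) * \<delta> powr q" using \<delta> by (simp flip: powr_add)
    also have "\<dots> \<le> \<delta> powr (- q) * r powr q"
      using False \<delta> q by (intro mult_left_mono powr_mono2) auto
    finally have "c * r powr n * 1 \<le> c * r powr n * (\<delta> powr (- q) * r powr q)"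
      using c by (intro mult_left_mono) auto
    also have "\<dots> = b * r powr (n + q)" unfolding b_def by (simp add: powr_add mult_ac)
    finally show ?thesis using measure_nonneg[of m "ball x0 r"] by linarith
  qed
  note lower = F_lower[OF _ b c this, folded G_def G2_def]
  have large: "E k \<le> E l" if l: "l > 0" "l \<ge> b * G2 / (c * G - E k)" for l
  proof -
    have "c * (l powr (- (n / q)) * G) * l powr (n / q) \<le> (F l + b * (l powr (- (n / q + 1)) * G2)) * l powr (n / q)"
      using lower[OF l(1)] by (intro mult_right_mono) auto
    also have "c * (l powr (- (n / q)) * G) * l powr (n / q) = c * G * (l powr (- (n / q)) * l powr (n / q))"
      by (simp add: mult_ac)
    also have "l powr (- (n / q)) * l powr (n / q) = 1" using l by (simp flip: powr_add)
    also have "(F l + b * (l powr (- (n / q + 1)) * G2)) * l powr (n / q) =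
        E l + b * G2 * (l powr (- (n / q + 1)) * l powr (n / q))"
      unfolding E_def by (simp add: algebra_simps)
    also have "l powr (- (n / q + 1)) * l powr (n / q) = 1 / l"
      using l by (simp add: powr_minus_divide flip: powr_add)
    finally have "c * G \<le> E l + b * G2 / l" by simp
    moreover have "b * G2 / l \<le> c * G - E k"
      using l cG by (simp add: field_simps)
    ultimately show ?thesis by linarith
  qed
  have dE: "(E has_real_derivative (- H l * l powr (n / q) + n / q * l powr (n / q - 1) * F l)) (at l)" if "l > 0" for l
    unfolding E_def using DERIV_mult[OF F_has_derivative[OF that] has_real_derivative_powr[OF that, of "n / q"]]
    by simp
  \<comment> \<open>Beyond M the fact \<open>large\<close> keeps \<open>E\<close> above
    \<open>E k\<close>, so a minimum on [k, M] is a minimum on [k, \<infinity>); the maximum with k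
    makes the interval nonempty.\<close>
  define M where "M = max k (b * G2 / (c * G - E k))"
  have "continuous_on {k..M} E"
    using k by (intro continuous_at_imp_continuous_on ballI DERIV_isCont[OF dE]) auto
  then obtain j where j: "j \<in> {k..M}" "\<And>l. l \<in> {k..M} \<Longrightarrow> E j \<le> E l"
    using continuous_attains_inf[of "{k..M}" E] by (auto simp: M_def)
  have j0: "j > 0" using j k by auto
  have Ejk: "E j \<le> E k" using j(2)[of k] by (simp add: M_def)
  have min: "E j \<le> E l" if "l \<ge> j" for l
  proof (cases "l \<le> M")
    case True
    then show ?thesis using j that by auto
  next
    case False
    then have "E k \<le> E l" using large[of l] j0 that by (simp add: M_def)
    then show ?thesis using Ejk by simp
  qed
  \<comment> \<open>The minimizer may be the left endpoint k, hence the comparison from the right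
    only. Dividing by \<open>j powr (n / q - 1)\<close> leaves the hypothesis of
    \<open>F_lower_critical\<close>.\<close>
  have "- H j * j powr (n / q) + n / q * j powr (n / q - 1) * F j \<ge> 0"
  proof (rule ccontr)
    assume "\<not> ?thesis"
    then obtain d where "d > 0" "\<forall>h>0. h < d \<longrightarrow> E (j + h) < E j"
      using DERIV_neg_dec_right[OF dE[OF j0]] by force
    then have "E (j + d / 2) < E j" by simp
    then show False using min[of "j + d / 2"] \<open>d > 0\<close> by simp
  qed
  also have "- H j * j powr (n / q) + n / q * j powr (n / q - 1) * F j =
      j powr (n / q - 1) * (n / q * F j - j * H j)"
    using j0 by (simp add: powr_diff field_simps)
  finally have "j * H j \<le> n / q * F j" using j0 by (simp add: zero_le_mult_iff)
  then have "\<kappa> \<le> E j" unfolding \<kappa>_def E_def G_def by (rule F_lower_critical[OF j0])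
  then show False using Ejk Ek by simp
qed

end

text \<open>A normalized constant has slope 0, so the argument of \<open>log0\<close> is 0 and the
  right-hand side is -\<infinity>, while the left-hand side is a real number.\<close>

lemma (in proper_mm_space) not_log_sobolev_compact:
  assumes comp: "compact (UNIV :: 'a set)" and p: "p > 0" and n: "n > 0"
  shows "\<not> log_sobolev m n p C"
proof
  assume lso: "log_sobolev m n p C"
  define M where "M = measure m UNIV"
  have bdd: "bounded (UNIV :: 'a set)" using comp by (rule compact_imp_bounded)
  have "measure m (ball x 1) \<le> M" for x
    unfolding M_def using bdd by (intro measure_mono_bounded) auto
  then have M: "M > 0" using measure_ball_pos[of 1] by (meson less_le_trans zero_less_one)
  define c where "c = M powr (- 1 / p)"
  have c: "c > 0" "c powr p = 1 / M"
    unfolding c_def using M p by (simp, simp only: powr_powr) (simp add: powr_minus_divide)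
  have Lip: "(\<lambda>x::'a. c) \<in> Lip0"
    unfolding Lip0_def using comp c by (auto intro!: exI[of _ 0] lipschitz_onI)
  have norm: "Lp_norm m p (\<lambda>x. c) = 1"
    unfolding Lp_norm_def using c M by (simp add: M_def)
  have slope: "local_slope (\<lambda>x::'a. c) = (\<lambda>x. 0)"
  proof
    fix x :: 'a
    have "local_slope (\<lambda>x::'a. c) x \<le> 0" by (rule local_slope_le[where k="\<lambda>_. 0"]) auto
    moreover have "local_slope (\<lambda>x::'a. c) x \<ge> 0" unfolding local_slope_def by (rule enn2real_nonneg)
    ultimately show "local_slope (\<lambda>x::'a. c) x = 0" by (rule antisym)
  qed
  from lso[unfolded log_sobolev_def, rule_format, OF Lip norm] show False using p n unfolding slope by (auto simp: Lp_norm_def log0_def split: if_splits)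
qed

theorem theorem1p2:
  fixes m :: "'a::polish_space measure"
    and n :: nat and K p C :: real and x0 :: 'a
  assumes "n \<ge> 2"
    and "K \<ge> 0"
    and "metric_measure_space m"
    and "proper_space TYPE('a)"
    and "CD K (real n) m"
    and "1 < p" and "p < real n"
    and "Liminf (at_right 0)
           (\<lambda>r. emeasure m (ball x0 r) / ennreal (unit_ball_vol (real n) * r ^ n)) = 1"
    and "C \<ge> log_sobolev_const p n"
    and "log_sobolev m n p C"
  shows "K = 0 \<and>
    (\<forall>x r. r \<ge> 0 \<longrightarrow>
       emeasure m (ball x r) \<ge>
         ennreal ((log_sobolev_const p n / C) powr (real n / p) * unit_ball_vol (real n) * r ^ n))"
proof -
  interpret cd_space m K "real n"
    using assms by unfold_locales auto
  have n: "n > 0" using assms(1) by simp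
  define \<omega> where "\<omega> = unit_ball_vol (real n)"
  have \<omega>: "\<omega> > 0" unfolding \<omega>_def by (rule unit_ball_vol_pos')
  have K: "K = 0"
    using compact_UNIV not_log_sobolev_compact[of p n C] assms(2,6,10) n by (cases "K = 0") auto
  have V: "emeasure m (ball x r) = ennreal (measure m (ball x r))" for x r
    by (rule emeasure_bounded) simp
  have bg: "measure m (ball x R) \<le> (R / r) ^ n * measure m (ball x r)" if "0 < r" "r \<le> R" for x r R
  proof -
    have "(R / r) ^ n * ((r / R) ^ n * measure m (ball x R)) \<le> (R / r) ^ n * measure m (ball x r)"
      using bishop_gromov[OF K that, of x] that by (intro mult_left_mono) (auto simp: powr_realpow)
    also have "(R / r) ^ n * ((r / R) ^ n * measure m (ball x R)) = ((R / r) * (r / R)) ^ n * measure m (ball x R)"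
      by (simp only: power_mult_distrib mult.assoc)
    finally show ?thesis using that by simp
  qed
  have ratio: "emeasure m (ball x0 r) / ennreal (unit_ball_vol (real n) * r ^ n) =
      ennreal (measure m (ball x0 r) / (\<omega> * r ^ n))" if "r > 0" for r
    unfolding V \<omega>_def[symmetric] using that \<omega> by (intro divide_ennreal) auto
  \<comment> \<open>The volume ratio is nonincreasing in the radius, so its value at R lies below
    the lower limit at 0, which is 1.\<close>
  have growth: "measure m (ball x0 R) \<le> \<omega> * R powr n" if R: "R > 0" for R
  proof -
    let ?v = "measure m (ball x0 R) / (\<omega> * R ^ n)"
    have "ennreal ?v \<le> Liminf (at_right 0)
           (\<lambda>r. emeasure m (ball x0 r) / ennreal (unit_ball_vol (real n) * r ^ n))"
    proof (rule Liminf_bounded)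
      show "\<forall>\<^sub>F r in at_right 0. ennreal ?v \<le> emeasure m (ball x0 r) / ennreal (unit_ball_vol (real n) * r ^ n)"
        using eventually_at_right_real[OF R]
      proof eventually_elim
        case (elim r)
        then have r: "r > 0" "r \<le> R" by auto
        have "measure m (ball x0 R) \<le> R ^ n / r ^ n * measure m (ball x0 r)"
          using bg[OF r, of x0] by (simp add: power_divide)
        then have "?v \<le> measure m (ball x0 r) / (\<omega> * r ^ n)"
          using r R \<omega> by (simp add: field_simps)
        then show ?case unfolding ratio[OF r(1)] by (rule ennreal_leI)
      qed
    qed
    then have "ennreal ?v \<le> 1" using assms(8) by simp
    then have "?v \<le> 1" by simp
    then show ?thesis using R \<omega> by (simp add: divide_le_eq powr_realpow)
  qed
  \<comment> \<open>The other half of the density assumption: every ratio below 1 is exceeded at all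
    small radii.\<close>
  have low: "\<exists>\<delta>>0. \<forall>r. 0 < r \<and> r < \<delta> \<longrightarrow> c * r powr n \<le> measure m (ball x0 r)"
    if c: "0 \<le> c" "c < unit_ball_vol n" for c
  proof -
    have "ennreal (c / \<omega>) < Liminf (at_right 0)
           (\<lambda>r. emeasure m (ball x0 r) / ennreal (unit_ball_vol (real n) * r ^ n))"
      unfolding assms(8) using c \<omega> by (simp add: \<omega>_def ennreal_less_one_iff)
    from less_LiminfD[OF this] obtain \<delta> where \<delta>: "\<delta> > 0"
      and d: "\<And>r. 0 < r \<Longrightarrow> r < \<delta> \<Longrightarrow> ennreal (c / \<omega>) < emeasure m (ball x0 r) / ennreal (unit_ball_vol (real n) * r ^ n)"
      unfolding eventually_at_right_field by auto
    have "c * r powr n \<le> measure m (ball x0 r)" if r: "0 < r" "r < \<delta>" for r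
    proof -
      have "c / \<omega> < measure m (ball x0 r) / (\<omega> * r ^ n)"
        using d[OF r] c \<omega> unfolding ratio[OF r(1)] by (simp add: ennreal_less_iff)
      then show ?thesis using r \<omega> by (simp add: field_simps powr_realpow)
    qed
    then show ?thesis using \<delta> by blast
  qed
  have C: "C > 0" using log_sobolev_const_pos[OF assms(6) n] assms(9) by linarith
  define q where "q = p / (p - 1)"
  have q: "q > 1" unfolding q_def using assms(6) by (simp add: field_simps)
  interpret log_sobolev_space m x0 q n \<omega> p C
    using q n growth assms(6,10) C by unfold_locales (auto simp: q_def)
  define G where "G = Gamma (n / q + 1)"
  have G: "G > 0" unfolding G_def by (rule Gamma_pos)
  define \<kappa> where "\<kappa> = (log_sobolev_const p n / C) powr (n / p) * \<omega>"
  have Fge: "\<kappa> * G \<le> F l * l powr (n / q)" if "l > 0" for l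
    unfolding \<kappa>_def G_def \<omega>_def using F_ge[OF assms(9) low that] by simp
  have main: "\<kappa> * r ^ n \<le> measure m (ball x r)" if r: "r > 0" for x r
  proof (rule ccontr)
    assume neg: "\<not> \<kappa> * r ^ n \<le> measure m (ball x r)"
    define b where "b = measure m (ball x r) / r ^ n"
    have b: "0 \<le> b" "b < \<kappa>" unfolding b_def using neg r by (auto simp: divide_less_eq)
    \<comment> \<open>The ratio b at radius r bounds the ratios about x at all larger radii. The gap
      between b and b' pays for moving the center to x0: this enlarges the radius s by d, a factor
      (1 + d / s)^n that tends to 1.\<close>
    define b' where "b' = (b + \<kappa>) / 2"
    have b': "b < b'" "b' < \<kappa>" unfolding b'_def using b by auto
    define d where "d = dist x x0"
    have "((\<lambda>s. b * (1 + d / s) ^ n) \<longlongrightarrow> b * (1 + 0) ^ n) at_top"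
      by (intro tendsto_intros tendsto_divide_0[OF tendsto_const] filterlim_at_top_imp_at_infinity filterlim_ident)
    then have "\<forall>\<^sub>F s in at_top. b * (1 + d / s) ^ n < b'"
      using b'(1) by (auto dest: order_tendstoD(2))
    then obtain R0 where R0: "\<And>s. s \<ge> R0 \<Longrightarrow> b * (1 + d / s) ^ n < b'"
      unfolding eventually_at_top_linorder by blast
    define R where "R = max R0 r"
    have R: "R > 0" "R \<ge> r" unfolding R_def using r by auto
    have large: "measure m (ball x0 s) \<le> b' * s ^ n" if s: "s \<ge> R" for s
    proof -
      have s0: "s > 0" using s R by linarith
      have "measure m (ball x0 s) \<le> measure m (ball x (s + d))"
      proof (intro measure_mono_bounded subsetI)
        fix y assume "y \<in> ball x0 s"
        then show "y \<in> ball x (s + d)"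
          using dist_triangle[of x y x0] by (simp add: d_def)
      qed auto
      also have "\<dots> \<le> ((s + d) / r) ^ n * measure m (ball x r)"
        using s R r by (intro bg) (auto simp: d_def intro: order_trans add_increasing2)
      also have "\<dots> = b * (1 + d / s) ^ n * s ^ n"
      proof -
        have "(1 + d / s) * s = s + d" using s0 by (simp add: distrib_right)
        then have "(1 + d / s) ^ n * s ^ n = (s + d) ^ n" by (metis power_mult_distrib)
        then show ?thesis unfolding b_def by (simp add: power_divide mult.assoc)
      qed
      also have "\<dots> \<le> b' * s ^ n"
        using R0[of s] s s0 unfolding R_def by (intro mult_right_mono) auto
      finally show ?thesis .
    qed
    have "measure m (ball x0 s) \<le> measure m (ball x0 R) + b' * s powr n" if s: "s > 0" for s
    proof (cases "s \<ge> R")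
      case True
      then show ?thesis using large[OF True] s measure_nonneg[of m "ball x0 R"]
        by (simp add: powr_realpow add_increasing)
    next
      case False
      then have "measure m (ball x0 s) \<le> measure m (ball x0 R)"
        by (intro measure_mono_bounded subset_ball) auto
      moreover have "0 \<le> b' * s powr n" using b b' by simp
      ultimately show ?thesis by linarith
    qed
    note up = F_upper[OF _ measure_nonneg _ this, folded G_def]
    \<comment> \<open>The contribution of the fixed ball of radius R now carries
      \<open>l powr (n / q)\<close>, which vanishes as l tends to 0 and leaves \<kappa> \<le>
      b'.\<close>
    have "\<kappa> * G \<le> measure m (ball x0 R) * l powr (n / q) + b' * G" if l: "l > 0" for l
    proof -
      have "\<kappa> * G \<le> F l * l powr (n / q)" by (rule Fge[OF l])
      also have "\<dots> \<le> (measure m (ball x0 R) + b' * (l powr (- (n / q)) * G)) * l powr (n / q)"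
        using up[OF l] b b' by (intro mult_right_mono) auto
      also have "\<dots> = measure m (ball x0 R) * l powr (n / q) + b' * G * (l powr (- (n / q)) * l powr (n / q))"
        by (simp add: algebra_simps)
      also have "l powr (- (n / q)) * l powr (n / q) = 1" using l by (simp flip: powr_add)
      finally show ?thesis by simp
    qed
    then have "\<forall>\<^sub>F l in at_right 0. \<kappa> * G \<le> measure m (ball x0 R) * l powr (n / q) + b' * G"
      by (auto simp: eventually_at_right_field intro: exI[of _ 1])
    moreover have "((\<lambda>l. measure m (ball x0 R) * l powr (n / q) + b' * G) \<longlongrightarrow>
        measure m (ball x0 R) * 0 + b' * G) (at_right 0)"
    proof (intro tendsto_intros)
      show "((\<lambda>l. l powr (n / q)) \<longlongrightarrow> 0) (at_right 0)"
        using Nq(1) by real_asymp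
    qed
    ultimately have "\<kappa> * G \<le> measure m (ball x0 R) * 0 + b' * G"
      by (intro tendsto_lowerbound) auto
    then show False using G b' by simp
  qed
  show ?thesis
  proof (intro conjI allI impI K)
    fix x r assume r: "(r::real) \<ge> 0"
    have "\<kappa> * r ^ n \<le> measure m (ball x r)"
      using main[of r x] r n by (cases "r = 0") (auto simp: power_0_left)
    then show "ennreal ((log_sobolev_const p n / C) powr (real n / p) * unit_ball_vol (real n) * r ^ n) \<le> emeasure m (ball x r)"
      unfolding V \<kappa>_def \<omega>_def by (intro ennreal_leI) simp
  qed
qed

end
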